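(* Let $f_\varepsilon(u)=e^{-|u|}/2$, $u\in\mathbb R$, be the standard Laplace density. Let $f_{0X}$ be a probability density on $\mathbb R$ such that $e^{|\cdot|/2}f_{0X}\in L^1(\mathbb R)$ and such that, for a given $\alpha>0$ and for both $b=-\tfrac12$ and $b=\tfrac12$, $\int_{\mathbb R}|t|^{2\alpha}|\widehat{(e^{b\cdot}f_{0X})}(t)|^2\,\mathrm dt<\infty$. Then, for $m\ge 2\vee\frac{\alpha+2}{2}$ ($m\in\mathbb N$) and $\sigma>0$ small enough, $$\sum_{b=\mp1/2}\big\|e^{b\cdot}\{f_\varepsilon\ast[\phi_\sigma\ast(T_{m,b,\sigma}f_{0X})-f_{0X}]\}\big\|_2^2\lesssim\sigma^{2(\alpha+2)}$$ and, for $b=-\tfrac12$ and $b=\tfrac12$, $$\int_{\mathbb R}h_{m,b,\sigma}(x)\,\mathrm dx=1+O(\sigma^{2(m-1)}).$$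
   Context: $\hat f(t)=\int_{\mathbb R} e^{\imath tx}f(x)\,\mathrm dx$; $\phi_\sigma(x)=\sigma^{-1}\phi(x/\sigma)$ with $\phi$ the standard normal density; $D^j$ is the $j$th derivative; $a\vee b=\max\{a,b\}$; $\|\cdot\|_2$ is the $L^2(\mathbb R)$ norm. $\lesssim$ and $O(\cdot)$ hide constants independent of $\sigma$. Let $\tau:\mathbb R\to[0,1]$ be a fixed function (a known construction of Bourgain type) with $\tau(u)=1$ if $|u|<1$ and $\tau(u)=0$ if $|u|>17/15$, whose Fourier transform satisfies $|\hat\tau(x)|\le(16^2/15)e^{-\sqrt{|x|/15}}$ for all $x\in\mathbb R$, is infinitely differentiable, and satisfies, for every $i\in\{0,1,2,\dots\}$ and every $\nu>0$, $|\hat\tau^{(i)}(x)|=O(|x|^{-\nu})$ for large $|x|$. For $h>0$ let $H(x):=\frac1{2\pi}\hat\tau(x)e^{-(hx)^2/2}$, $x\in\mathbb R$, and for $\delta>0$ let $H_\delta(x):=\delta^{-1}H(x/\delta)$. Here $h$ and $\delta$ are bandwidths of the construction: $\delta$ is chosen proportional to $\sigma$, so that the operator below does not ultimately depend on $\delta$, and $h$ is likewise chosen as a function of $\sigma$ (the paper's construction takes $\delta=c_\delta\sigma$ and $h=c_h|\log\sigma|^{-1/2}$ for constants $0<c_\delta,c_h<1$). For $m\in\mathbb N$, $b=\mp\frac12$, $\delta,\sigma>0$ and $f:\mathbb R\to\mathbb R$, define $$T_{m,b,\sigma}f:=f+\sum_{k=1}^{m-1}\frac{(-\sigma^2/2)^k}{k!}\sum_{j=0}^{2k}\binom{2k}{j}(-b)^{2k-j}\,[f\ast(e^{-b\cdot}D^jH_\delta)].$$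 With $M_{0X}(b):=\int_{\mathbb R} e^{bx}f_{0X}(x)\,\mathrm dx$, $\bar h_{0,b}:=e^{b\cdot}f_{0X}/M_{0X}(b)$ and $\gamma:=-(1-e^{-\sigma^2/8})$, define $$h_{m,b,\sigma}:=\frac1\gamma\sum_{k=1}^{m-1}\frac{(-\sigma^2/2)^k}{k!}\sum_{j=0}^{2k}\binom{2k}{j}(-b)^{2k-j}(\bar h_{0,b}\ast D^jH_\delta).$$
   Formalization: The bandwidth constant c_h in h = c_h|log σ|^{-1/2} is taken sufficiently small (below a c_0 depending only on τ, α, m) instead of any value in (0,1), since for c_h near 1 the claim on the integral of h_{m,b,σ} fails. *)

theory Defs
  imports "HOL-Probability.Probability" "HOL-Library.Landau_Symbols"
begin

text \<open>
  Real densities are kept real. Everything built from the Fourier transform of the cutoff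
  function is complex-valued, because no symmetry of the cutoff is assumed; for an even cutoff
  these functions are real.
\<close>

definition fourier :: "(real \<Rightarrow> real) \<Rightarrow> real \<Rightarrow> complex" where
  "fourier f t = (LINT x|lborel. f x *\<^sub>R iexp (t * x))"

definition conv :: "(real \<Rightarrow> real) \<Rightarrow> (real \<Rightarrow> complex) \<Rightarrow> real \<Rightarrow> complex" where
  "conv f g x = (LINT y|lborel. f (x - y) *\<^sub>R g y)"

definition nderiv :: "nat \<Rightarrow> (real \<Rightarrow> complex) \<Rightarrow> real \<Rightarrow> complex" where
  "nderiv j g = ((\<lambda>u x. vector_derivative u (at x)) ^^ j) g"

definition smooth :: "(real \<Rightarrow> complex) \<Rightarrow> bool" where
  "smooth g \<longleftrightarrow> (\<forall>j x. nderiv j g differentiable (at x))"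

text \<open>Squared norm as an extended nonnegative integral, so that a finite bound on it includes
  membership in the space of square-integrable functions.\<close>

definition L2norm_sq :: "(real \<Rightarrow> complex) \<Rightarrow> ennreal" where
  "L2norm_sq g = (\<integral>\<^sup>+x. ennreal ((cmod (g x))\<^sup>2) \<partial>lborel)"

definition probability_density :: "(real \<Rightarrow> real) \<Rightarrow> bool" where
  "probability_density f \<longleftrightarrow>
     f \<in> borel_measurable borel \<and> (\<forall>x. 0 \<le> f x) \<and> (\<integral>\<^sup>+x. ennreal (f x) \<partial>lborel) = 1"

definition laplace_density :: "real \<Rightarrow> real" where
  "laplace_density u = exp (- \<bar>u\<bar>) / 2"

definition gauss_kernel :: "real \<Rightarrow> real \<Rightarrow> real" where
  "gauss_kernel \<sigma> x = std_normal_density (x / \<sigma>) / \<sigma>"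

definition bourgain_cutoff :: "(real \<Rightarrow> real) \<Rightarrow> bool" where
  "bourgain_cutoff \<tau> \<longleftrightarrow>
     \<tau> \<in> borel_measurable borel \<and>
     (\<forall>u. 0 \<le> \<tau> u \<and> \<tau> u \<le> 1) \<and>
     (\<forall>u. \<bar>u\<bar> < 1 \<longrightarrow> \<tau> u = 1) \<and>
     (\<forall>u. \<bar>u\<bar> > 17 / 15 \<longrightarrow> \<tau> u = 0) \<and>
     (\<forall>x. cmod (fourier \<tau> x) \<le> (16\<^sup>2 / 15) * exp (- sqrt (\<bar>x\<bar> / 15))) \<and>
     smooth (fourier \<tau>) \<and>
     (\<forall>i. \<forall>\<nu>>0. (\<lambda>x. cmod (nderiv i (fourier \<tau>) x)) \<in> O[at_infinity](\<lambda>x. \<bar>x\<bar> powr (- \<nu>)))"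

definition H_fun :: "(real \<Rightarrow> real) \<Rightarrow> real \<Rightarrow> real \<Rightarrow> complex" where
  "H_fun \<tau> h x = (1 / (2 * pi) * exp (- ((h * x)\<^sup>2 / 2))) *\<^sub>R fourier \<tau> x"

definition H_scaled :: "(real \<Rightarrow> real) \<Rightarrow> real \<Rightarrow> real \<Rightarrow> real \<Rightarrow> complex" where
  "H_scaled \<tau> h \<delta> x = (1 / \<delta>) *\<^sub>R H_fun \<tau> h (x / \<delta>)"

definition T_op ::
    "(real \<Rightarrow> real) \<Rightarrow> real \<Rightarrow> real \<Rightarrow> nat \<Rightarrow> real \<Rightarrow> real \<Rightarrow> (real \<Rightarrow> real) \<Rightarrow> real \<Rightarrow> complex" where
  "T_op \<tau> h \<delta> m b \<sigma> f x = complex_of_real (f x) +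
     (\<Sum>k\<in>{1..<m}. ((- \<sigma>\<^sup>2 / 2) ^ k / fact k) *\<^sub>R
        (\<Sum>j\<le>2 * k. (real (2 * k choose j) * (- b) ^ (2 * k - j)) *\<^sub>R
           conv f (\<lambda>y. exp (- b * y) *\<^sub>R nderiv j (H_scaled \<tau> h \<delta>) y) x))"

definition mgf :: "(real \<Rightarrow> real) \<Rightarrow> real \<Rightarrow> real" where
  "mgf f b = (LINT x|lborel. exp (b * x) * f x)"

definition tilted_density :: "(real \<Rightarrow> real) \<Rightarrow> real \<Rightarrow> real \<Rightarrow> real" where
  "tilted_density f b x = exp (b * x) * f x / mgf f b"

definition h_corr ::
    "(real \<Rightarrow> real) \<Rightarrow> real \<Rightarrow> real \<Rightarrow> nat \<Rightarrow> real \<Rightarrow> real \<Rightarrow> (real \<Rightarrow> real) \<Rightarrow> real \<Rightarrow> complex" where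
  "h_corr \<tau> h \<delta> m b \<sigma> f x = (let \<gamma> = - (1 - exp (- \<sigma>\<^sup>2 / 8)) in
     (1 / \<gamma>) *\<^sub>R
     (\<Sum>k\<in>{1..<m}. ((- \<sigma>\<^sup>2 / 2) ^ k / fact k) *\<^sub>R
        (\<Sum>j\<le>2 * k. (real (2 * k choose j) * (- b) ^ (2 * k - j)) *\<^sub>R
           conv (tilted_density f b) (nderiv j (H_scaled \<tau> h \<delta>)) x)))"

text \<open>The constant \<open>c\<close> must be small relative to \<open>m\<close> and \<open>\<alpha>\<close>: the integral of \<open>h_corr\<close> contains the
  factor E(\<open>\<tau>\<close>(hN)) with N standard normal, and 1 minus this factor is at least P(h|N| > 17/15), which
  decays like a power of \<open>\<sigma>\<close> with exponent of order \<open>c\<close> to the power -2.\<close>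

definition bandwidth_h :: "real \<Rightarrow> real \<Rightarrow> real" where
  "bandwidth_h c \<sigma> = c * \<bar>ln \<sigma>\<bar> powr (- (1 / 2))"

definition bandwidth_delta :: "real \<Rightarrow> real \<Rightarrow> real" where
  "bandwidth_delta c \<sigma> = c * \<sigma>"

end

theory Submission
  imports Defs "HOL-Computational_Algebra.Polynomial"
begin

text \<open>
  Multiplying by \<open>e\<^bsup>bx\<^esup>\<close> turns every convolution into one of tilted functions. With
  \<open>g = e\<^bsup>b\<cdot>\<^esup>f\<^sub>0\<close>, \<open>z = \<sigma>\<^sup>2(b + it)\<^sup>2/2\<close> and the smoothed cutoff
  \<open>E(t) = \<integral>\<tau>(u)\<phi>\<^sub>h(u + \<delta>t)du\<close>, which is the Fourier transform of the kernel, the binomial theorem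
  shows that the transform of the tilted difference is that of \<open>g\<close> divided by \<open>1 - (b + it)\<^sup>2\<close>
  and multiplied by \<open>A(t) = e\<^sup>z (1 + E(t) S(t)) - 1\<close>, where \<open>S\<close> is the sum of \<open>(-z)\<^sup>k/k!\<close> over
  \<open>1 \<le> k < m\<close>.
  Since \<open>1 + S\<close> is a Taylor section of \<open>e\<^bsup>-z\<^esup>\<close> and \<open>1 - E\<close> is a Gaussian tail, of order \<open>\<sigma>\<^bsup>2m\<^esup>\<close> by the
  choice of \<open>h\<close>, \<open>A(t)\<close> is \<open>O((\<sigma>(1 + \<bar>t\<bar>))\<^bsup>\<alpha>+2\<^esup>)\<close>. The Laplace factor absorbs two powers of
  \<open>1 + \<bar>t\<bar>\<close>, the Sobolev condition the others, and Plancherel concludes. The integral of \<open>h_corr\<close>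
  is the value at \<open>t = 0\<close> of the same expansion.
\<close>

section \<open>Fourier transform and convolution\<close>

text \<open>The obstacle is high frequency: there \<open>S\<close> may be as large as
  \<open>exp (norm z)\<close>, and what saves the estimate is that the Gaussian factor
  \<open>exp z\<close> decays at that same rate. The frequencies are therefore split at
  \<open>\<sigma> * \<bar>t\<bar> = 1 / 2\<close>. Beyond it a constant bound is enough, because
  powers of \<open>\<sigma> * (1 + \<bar>t\<bar>)\<close> are bounded below there. Up to it the
  smoothed cutoff must be close to 1: as \<open>c\<^sub>\<delta> < 1\<close>, the Gaussian average
  is centred within \<open>1 / 2\<close> of the origin, hence at distance at least
  \<open>1 / 2\<close> from the points where \<open>\<tau>\<close> may differ from 1. The resulting
  tail \<open>exp (- 1 / (16 * h\<^sup>2))\<close> is, for the logarithmic bandwidth,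
  \<open>\<sigma>\<close> to the power \<open>1 / (16 * c\<^sub>h\<^sup>2)\<close>, and
  \<open>c\<^sub>h \<le> 1 / (4 * m)\<close> makes this exponent at least \<open>m\<^sup>2\<close>,
  hence at least \<open>2 * m\<close>. Plancherel enters as an inequality for bounded continuous
  integrable functions; convolution with the bounded continuous tilted Laplace density puts the
  difference into this class.\<close>

definition ft :: "(real \<Rightarrow> complex) \<Rightarrow> real \<Rightarrow> complex" where
  "ft g t = (LINT x|lborel. g x * iexp (t * x))"

text \<open>\<open>fourier\<close> takes real functions, while the kernel and all that is convolved
  with it are complex; \<open>ft\<close> covers the latter, and this link carries its properties
  back.\<close>

lemma fourier_eq_ft: "fourier f t = ft (\<lambda>x. complex_of_real (f x)) t"
  by (simp add: fourier_def ft_def scaleR_conv_of_real)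

lemma integrable_mult_bounded:
  fixes f g :: "'a \<Rightarrow> complex"
  assumes "integrable M f" "g \<in> borel_measurable M" "\<And>x. norm (g x) \<le> C"
  shows "integrable M (\<lambda>x. f x * g x)"
proof -
  have [measurable]: "f \<in> borel_measurable M" "g \<in> borel_measurable M"
    using assms by auto
  have "integrable M (\<lambda>x. of_real C * f x)"
    using assms by auto
  then show ?thesis
  proof (rule Bochner_Integration.integrable_bound)
    show "AE x in M. norm (f x * g x) \<le> norm (of_real C * f x)"
    proof (rule AE_I2)
      fix x
      have "norm (g x) \<le> \<bar>C\<bar>" using assms(3)[of x] by linarith
      then show "norm (f x * g x) \<le> norm (of_real C * f x)"
        by (simp add: norm_mult) (subst mult.commute, rule mult_right_mono, auto)
    qed
  qed simp
qed

lemma integrable_mult_iexp: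
  assumes "integrable lborel g"
  shows "integrable lborel (\<lambda>x. g x * iexp (t * x))"
  by (rule integrable_mult_bounded[OF assms, where C = 1]) auto

lemma borel_measurable_ft [measurable]:
  assumes [measurable]: "g \<in> borel_measurable borel"
  shows "ft g \<in> borel_measurable borel"
  unfolding ft_def by (measurable)

lemma norm_ft_le: "norm (ft g t) \<le> (LINT x|lborel. norm (g x))"
proof -
  have "norm (ft g t) \<le> (LINT x|lborel. norm (g x * iexp (t * x)))"
    unfolding ft_def by (rule integral_norm_bound)
  then show ?thesis by (simp add: norm_mult)
qed

lemma ft_add: "integrable lborel f \<Longrightarrow> integrable lborel g \<Longrightarrow> ft (\<lambda>x. f x + g x) t = ft f t + ft g t"
  unfolding ft_def distrib_right by (intro Bochner_Integration.integral_add integrable_mult_iexp)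

lemma ft_diff: "integrable lborel f \<Longrightarrow> integrable lborel g \<Longrightarrow> ft (\<lambda>x. f x - g x) t = ft f t - ft g t"
  unfolding ft_def left_diff_distrib by (intro Bochner_Integration.integral_diff integrable_mult_iexp)

lemma ft_scaleR: "ft (\<lambda>x. c *\<^sub>R f x) t = c *\<^sub>R ft f t"
  unfolding ft_def by simp

lemma ft_sum:
  "finite I \<Longrightarrow> (\<And>i. i \<in> I \<Longrightarrow> integrable lborel (f i)) \<Longrightarrow>
    ft (\<lambda>x. \<Sum>i\<in>I. f i x) t = (\<Sum>i\<in>I. ft (f i) t)"
  unfolding ft_def sum_distrib_right by (intro Bochner_Integration.integral_sum integrable_mult_iexp)

text \<open>Fubini: both sides are the double integral of \<open>u x * v y * iexp (x * y)\<close>,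
  whose kernel is symmetric. With a modulated Gaussian as \<open>u\<close> it yields both the
  regularised inversion formula and the transform of the kernel.\<close>

lemma ft_multiplication_formula:
  assumes u: "integrable lborel u" and v: "integrable lborel v"
  shows "(LINT x|lborel. u x * ft v x) = (LINT t|lborel. ft u t * v t)"
proof -
  have [measurable]: "u \<in> borel_measurable borel" "v \<in> borel_measurable borel"
    using u v by auto
  have int: "integrable (lborel \<Otimes>\<^sub>M lborel) (\<lambda>(x, y). u x * (v y * iexp (x * y)))"
  proof (rule lborel_pair.Fubini_integrable)
    have "integrable lborel (\<lambda>x. norm (u x) * (LINT y|lborel. norm (v y)))"
      using u by auto
    then show "integrable lborel (\<lambda>x. LINT y|lborel. norm (case (x, y) of (x, y) \<Rightarrow> u x * (v y * iexp (x * y))))"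
      by (simp add: norm_mult)
    show "AE x in lborel. integrable lborel (\<lambda>y. case (x, y) of (x, y) \<Rightarrow> u x * (v y * iexp (x * y)))"
      using integrable_mult_iexp[OF v] by simp
  qed measurable
  have "(LINT x|lborel. u x * ft v x) = (LINT x|lborel. LINT y|lborel. u x * (v y * iexp (x * y)))"
    by (simp add: ft_def)
  also have "\<dots> = (LINT y|lborel. LINT x|lborel. u x * (v y * iexp (x * y)))"
    using lborel_pair.Fubini_integral[OF int] by simp
  also have "\<dots> = (LINT y|lborel. LINT x|lborel. u x * iexp (y * x) * v y)"
    by (simp add: mult_ac)
  also have "\<dots> = (LINT y|lborel. ft u y * v y)"
    unfolding ft_def by (subst integral_mult_left_zero) simp
  finally show ?thesis .
qed

text \<open>The pair is ordered \<open>(y, x)\<close> so that the inner integral over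
  \<open>x\<close> is translation invariant: it is the L1 norm of \<open>f\<close> times
  \<open>norm (g y)\<close>.\<close>

lemma integrable_conv_pair:
  fixes f :: "real \<Rightarrow> real" and g :: "real \<Rightarrow> complex"
  assumes f: "integrable lborel f" and g: "integrable lborel g"
  shows "integrable (lborel \<Otimes>\<^sub>M lborel) (\<lambda>(y, x). f (x - y) *\<^sub>R g y)"
proof (rule lborel_pair.Fubini_integrable)
  have [measurable]: "f \<in> borel_measurable borel" "g \<in> borel_measurable borel"
    using f g by auto
  show "(\<lambda>(y, x). f (x - y) *\<^sub>R g y) \<in> borel_measurable (lborel \<Otimes>\<^sub>M lborel)"
    by measurable
  have *: "integrable lborel (\<lambda>x. f (x - y))" for y
    using lborel_integrable_real_affine[OF f, of 1 "-y"] by simp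
  show "AE y in lborel. integrable lborel (\<lambda>x. case (y, x) of (y, x) \<Rightarrow> f (x - y) *\<^sub>R g y)"
    using * by simp
  have "(LINT x|lborel. norm (f (x - y))) = (LINT x|lborel. norm (f x))" for y
    using lborel_integral_real_affine[of 1 "\<lambda>x. norm (f x)" "-y"] by simp
  then show "integrable lborel (\<lambda>y. LINT x|lborel. norm (case (y, x) of (y, x) \<Rightarrow> f (x - y) *\<^sub>R g y))"
    using g by simp
qed

lemma integrable_conv:
  assumes f: "integrable lborel f" and g: "integrable lborel g"
  shows "integrable lborel (conv f g)"
  using lborel_pair.integrable_fst'[OF lborel_pair.integrable_product_swap[OF integrable_conv_pair[OF f g]]]
  unfolding conv_def by simp

lemma ft_conv:
  assumes f: "integrable lborel f" and g: "integrable lborel g"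
  shows "ft (conv f g) t = fourier f t * ft g t"
proof -
  have [measurable]: "f \<in> borel_measurable borel" "g \<in> borel_measurable borel"
    using f g by auto
  have int: "integrable (lborel \<Otimes>\<^sub>M lborel) (\<lambda>(y, x). f (x - y) *\<^sub>R g y * iexp (t * x))"
    using integrable_mult_bounded[OF integrable_conv_pair[OF f g], of "\<lambda>(y, x). iexp (t * x)" 1]
    by (simp add: case_prod_unfold)
  have "ft (conv f g) t = (LINT x|lborel. LINT y|lborel. f (x - y) *\<^sub>R g y * iexp (t * x))"
    unfolding ft_def conv_def by (simp flip: integral_mult_left_zero)
  also have "\<dots> = (LINT y|lborel. LINT x|lborel. f (x - y) *\<^sub>R g y * iexp (t * x))"
    using lborel_pair.Fubini_integral[OF int] by simp
  also have "\<dots> = (LINT y|lborel. fourier f t * (g y * iexp (t * y)))"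
  proof (rule Bochner_Integration.integral_cong[OF refl])
    fix y
    have "(LINT x|lborel. f (x - y) *\<^sub>R g y * iexp (t * x))
      = (LINT x|lborel. f x *\<^sub>R g y * iexp (t * (y + x)))"
      using lborel_integral_real_affine[of 1 "\<lambda>x. f (x - y) *\<^sub>R g y * iexp (t * x)" y] by simp
    also have "\<dots> = (LINT x|lborel. f x *\<^sub>R iexp (t * x) * (g y * iexp (t * y)))"
      by (simp add: distrib_left exp_add scaleR_conv_of_real mult_ac)
    also have "\<dots> = fourier f t * (g y * iexp (t * y))"
      unfolding fourier_def by (rule integral_mult_left_zero)
    finally show "(LINT x|lborel. f (x - y) *\<^sub>R g y * iexp (t * x)) = fourier f t * (g y * iexp (t * y))" .
  qed
  also have "\<dots> = fourier f t * ft g t"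
    unfolding ft_def by simp
  finally show ?thesis .
qed

section \<open>Gaussian kernels and their transforms\<close>

lemma fourier_std_normal: "(LINT x|lborel. std_normal_density x *\<^sub>R iexp (t * x)) = complex_of_real (exp (- t\<^sup>2 / 2))"
proof -
  have "char std_normal_distribution t = (LINT x|lborel. std_normal_density x *\<^sub>R iexp (t * x))"
    unfolding char_def 
    by (subst integral_density) auto
  then show ?thesis by (simp add: char_std_normal_distribution)
qed

lemma fourier_scaled:
  assumes "s > 0"
  shows "fourier (\<lambda>x. f (x / s) / s) t = fourier f (s * t)"
proof -
  have "fourier (\<lambda>x. f (x / s) / s) t = s *\<^sub>R (LINT x|lborel. (f x / s) *\<^sub>R iexp (t * (s * x)))"
    unfolding fourier_def using assms
    by (subst lborel_integral_real_affine[of s _ 0]) auto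
  also have "\<dots> = (LINT x|lborel. s *\<^sub>R (f x / s) *\<^sub>R iexp (t * (s * x)))"
    by (rule integral_scaleR_right[symmetric])
  also have "\<dots> = fourier f (s * t)"
    unfolding fourier_def using assms by (simp add: mult_ac)
  finally show ?thesis .
qed

lemma fourier_gauss_kernel:
  assumes "s > 0"
  shows "fourier (gauss_kernel s) t = complex_of_real (exp (- (s * t)\<^sup>2 / 2))"
  using fourier_scaled[OF assms, of std_normal_density t] fourier_std_normal[of "s * t"]
  by (simp add: gauss_kernel_def[abs_def] fourier_def)

lemma gauss_kernel_eq_normal_density: "s > 0 \<Longrightarrow> gauss_kernel s x = normal_density 0 s x"
  unfolding gauss_kernel_def std_normal_density_def normal_density_def
  by (simp add: real_sqrt_mult power_divide field_simps)

lemma borel_measurable_gauss_kernel [measurable]: "gauss_kernel s \<in> borel_measurable borel"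
  unfolding gauss_kernel_def[abs_def] by measurable

lemma integrable_gauss_kernel: "s > 0 \<Longrightarrow> integrable lborel (gauss_kernel s)"
  using integrable_normal_density[of s 0] by (simp add: gauss_kernel_eq_normal_density cong: Bochner_Integration.integrable_cong)

lemma integral_gauss_kernel: "s > 0 \<Longrightarrow> (LINT x|lborel. gauss_kernel s x) = 1"
  using integral_normal_density[of s 0] by (simp add: gauss_kernel_eq_normal_density)

section \<open>The Plancherel inequality\<close>

text \<open>The dilated density is \<open>gauss_kernel (1 / e)\<close> up to the factor
  \<open>1 / e\<close>, so its transform is a Gaussian of width \<open>e\<close>: a wide Gaussian
  weight in frequency is an approximate identity in space.\<close>

lemma fourier_std_normal_dilated:
  assumes "e > 0"
  shows "fourier (\<lambda>t. std_normal_density (e * t)) y = complex_of_real (sqrt (2 * pi) * gauss_kernel e y)"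
proof -
  have "fourier (\<lambda>t. std_normal_density (e * t)) y = (1 / e) *\<^sub>R fourier (gauss_kernel (1 / e)) y"
    unfolding fourier_def gauss_kernel_def using assms
    by (simp add: mult.commute flip: integral_scaleR_right)
  also have "\<dots> = complex_of_real (sqrt (2 * pi) * gauss_kernel e y)"
    using assms by (subst fourier_gauss_kernel)
      (auto simp: scaleR_conv_of_real gauss_kernel_def std_normal_density_def power_divide)
  finally show ?thesis .
qed

text \<open>Modulation becomes a shift. The lemma serves twice: with \<open>e\<close> a
  regularisation parameter in the Plancherel inequality, and with \<open>e\<close> the bandwidth
  \<open>h\<close> of the kernel.\<close>

lemma ft_modulated_gauss:
  assumes "e > 0"
  shows "ft (\<lambda>t. complex_of_real (std_normal_density (e * t)) * iexp (s * t)) y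
    = complex_of_real (sqrt (2 * pi) * gauss_kernel e (y + s))"
proof -
  have "ft (\<lambda>t. complex_of_real (std_normal_density (e * t)) * iexp (s * t)) y
      = fourier (\<lambda>t. std_normal_density (e * t)) (y + s)"
    unfolding ft_def fourier_def
    by (intro Bochner_Integration.integral_cong) (auto simp: scaleR_conv_of_real algebra_simps simp flip: exp_add)
  then show ?thesis using fourier_std_normal_dilated[OF assms] by simp
qed

lemma std_normal_density_le: "std_normal_density x \<le> 1 / sqrt (2 * pi)"
  unfolding std_normal_density_def by (simp add: divide_right_mono)

lemma integrable_std_normal_dilated:
  assumes "e \<noteq> 0"
  shows "integrable lborel (\<lambda>t. std_normal_density (e * t))"
  using lborel_integrable_real_affine[OF integrable_normal_density[of 1 0], of e 0] assms by simp

text \<open>The width is placed in the argument of \<open>F\<close> rather than in the density, so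
  that one multiple of the density dominates the integrands for all \<open>n\<close>.\<close>

lemma gauss_smoothing_tendsto:
  assumes "continuous_on UNIV F" and B: "\<And>x. norm (F x) \<le> B"
  shows "(\<lambda>n. LINT z|lborel. std_normal_density z *\<^sub>R (F (x + inverse (real (Suc n)) * z) :: complex)) \<longlonglongrightarrow> F x"
proof -
  have [measurable]: "F \<in> borel_measurable borel"
    using assms(1) by (rule borel_measurable_continuous_onI)
  have "(\<lambda>n. LINT z|lborel. std_normal_density z *\<^sub>R F (x + inverse (real (Suc n)) * z))
      \<longlonglongrightarrow> (LINT z|lborel. std_normal_density z *\<^sub>R F x)"
  proof (rule integral_dominated_convergence[where w = "\<lambda>z. B * std_normal_density z"])
    show "AE z in lborel. (\<lambda>n. std_normal_density z *\<^sub>R F (x + inverse (real (Suc n)) * z)) \<longlonglongrightarrow> std_normal_density z *\<^sub>R F x"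
    proof (rule AE_I2)
      fix z
      have "isCont F x" using assms(1) by (simp add: continuous_on_eq_continuous_at)
      moreover have "(\<lambda>n. x + inverse (real (Suc n)) * z) \<longlonglongrightarrow> x"
        by (rule tendsto_eq_intros LIMSEQ_inverse_real_of_nat refl | simp)+
      ultimately have "(\<lambda>n. F (x + inverse (real (Suc n)) * z)) \<longlonglongrightarrow> F x"
        by (rule isCont_tendsto_compose)
      then show "(\<lambda>n. std_normal_density z *\<^sub>R F (x + inverse (real (Suc n)) * z)) \<longlonglongrightarrow> std_normal_density z *\<^sub>R F x"
        by (intro tendsto_intros)
    qed
    show "AE z in lborel. norm (std_normal_density z *\<^sub>R F (x + inverse (real (Suc n)) * z)) \<le> B * std_normal_density z" for n
      using B by (auto simp: mult.commute[of B] intro!: mult_left_mono AE_I2)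
  qed (auto intro!: integrable_normal_density)
  moreover have "(LINT z|lborel. std_normal_density z *\<^sub>R F x) = F x"
    by (subst integral_scaleR_left) (auto intro!: integrable_normal_density simp: integral_normal_density)
  ultimately show ?thesis by simp
qed

text \<open>This is Fourier inversion with a Gaussian summability factor. It is the multiplication
  formula for the Gaussian modulated by \<open>- x\<close>, followed by the substitution
  \<open>y = x + e * z\<close>.\<close>

lemma gauss_smoothing_eq_ft:
  assumes F: "integrable lborel F" and e: "e > 0"
  shows "complex_of_real (sqrt (2 * pi)) * (LINT z|lborel. std_normal_density z *\<^sub>R F (x + e * z))
    = ft (\<lambda>t. std_normal_density (e * t) *\<^sub>R ft F t) (- x)"
proof -
  define u where "u t = complex_of_real (std_normal_density (e * t)) * iexp (- x * t)" for t
  have u: "integrable lborel u"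
    unfolding u_def using e
    by (intro integrable_mult_iexp integrable_of_real integrable_std_normal_dilated) auto
  have ft_u: "ft u y = complex_of_real (sqrt (2 * pi) * gauss_kernel e (y - x))" for y
    using ft_modulated_gauss[OF e, of "- x" y] by (simp add: u_def[abs_def])
  have "ft (\<lambda>t. std_normal_density (e * t) *\<^sub>R ft F t) (- x) = (LINT t|lborel. u t * ft F t)"
    unfolding ft_def[of _ "-x"] u_def
    by (intro Bochner_Integration.integral_cong) (auto simp: scaleR_conv_of_real mult_ac)
  also have "\<dots> = (LINT y|lborel. ft u y * F y)"
    by (rule ft_multiplication_formula[OF u F])
  also have "\<dots> = (LINT y|lborel. complex_of_real (sqrt (2 * pi)) * (gauss_kernel e (y - x) *\<^sub>R F y))"
    unfolding ft_u by (simp add: scaleR_conv_of_real mult_ac)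
  also have "\<dots> = complex_of_real (sqrt (2 * pi)) * (LINT y|lborel. gauss_kernel e (y - x) *\<^sub>R F y)"
    by (rule integral_mult_right_zero)
  also have "(LINT y|lborel. gauss_kernel e (y - x) *\<^sub>R F y)
     = e *\<^sub>R (LINT z|lborel. gauss_kernel e (e * z) *\<^sub>R F (x + e * z))"
    using e by (subst lborel_integral_real_affine[of e _ x]) auto
  also have "\<dots> = (LINT z|lborel. std_normal_density z *\<^sub>R F (x + e * z))"
    unfolding gauss_kernel_def using e by (simp flip: integral_scaleR_right)
  finally show ?thesis by simp
qed

text \<open>\<open>F\<close> is paired with its Gaussian smoothing \<open>R e\<close>. The
  multiplication formula turns the pairing into the integral of the squared transform against a
  Gaussian weight, which is at most \<open>1 / sqrt (2 * pi)\<close>; as \<open>e\<close> tends to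
  0, the pairing tends to the integral of the square of \<open>F\<close>. Boundedness and
  integrability of \<open>F\<close> together make that square integrable.\<close>

lemma L2norm_sq_le_ft:
  assumes F: "integrable lborel F" and cont: "continuous_on UNIV F" and B: "\<And>x. norm (F x) \<le> B"
    and sq: "integrable lborel (\<lambda>t. (norm (ft F t))\<^sup>2)"
  shows "L2norm_sq F \<le> ennreal ((LINT t|lborel. (norm (ft F t))\<^sup>2) / (2 * pi))"
proof -
  have [measurable]: "F \<in> borel_measurable borel" using F by auto
  have [measurable]: "(\<lambda>x. cnj (F x)) \<in> borel_measurable borel"
    using borel_measurable_integrable[OF integrable_cnj[OF F]] by simp
  define R where "R e x = (LINT z|lborel. std_normal_density z *\<^sub>R F (x + e * z))" for e x
  have [measurable]: "R e \<in> borel_measurable borel" for e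
    unfolding R_def by measurable
  have B0: "0 \<le> B" using B[of 0] norm_ge_zero order_trans by blast
  have RB: "norm (R e x) \<le> B" for e x
  proof -
    have "norm (R e x) \<le> (LINT z|lborel. norm (std_normal_density z *\<^sub>R F (x + e * z)))"
      unfolding R_def by (rule integral_norm_bound)
    also have "\<dots> \<le> (LINT z|lborel. B * std_normal_density z)"
      using B by (intro integral_mono') (auto simp: mult.commute[of B] B0 intro!: mult_left_mono)
    finally have "norm (R e x) \<le> (LINT z|lborel. B * std_normal_density z)" .
    then show ?thesis by simp
  qed
  have id: "(LINT x|lborel. cnj (F x) * R e x)
      = complex_of_real ((LINT t|lborel. (norm (ft F t))\<^sup>2 * std_normal_density (e * t)) / sqrt (2 * pi))"
    if e: "e > 0" for e
  proof -
    define w where "w t = std_normal_density (e * t) *\<^sub>R ft F t" for t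
    \<comment> \<open>The reflection is there because \<open>ft w\<close> occurs at
      \<open>- x\<close>; it makes \<open>ft v\<close> the conjugate of \<open>ft F\<close>, so that
      the product becomes a squared modulus.\<close>
    define v where "v x = cnj (F (- x))" for x
    have w: "integrable lborel w"
      unfolding w_def scaleR_conv_of_real
      by (rule integrable_mult_bounded[OF _ _ norm_ft_le])
         (use e integrable_std_normal_dilated[of e] in auto)
    have Fm: "integrable lborel (\<lambda>x. F (- x))"
      using lborel_integrable_real_affine[OF F, of "-1" 0] by simp
    have v: "integrable lborel v"
      unfolding v_def using Fm by (simp add: integrable_cnj)
    have ftv: "ft v t = cnj (ft F t)" for t
    proof -
      have "ft v t = (LINT x|lborel. cnj (F (- x) * iexp (t * (- x))))"
        unfolding ft_def v_def by (intro Bochner_Integration.integral_cong) (auto simp: exp_cnj)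
      also have "\<dots> = cnj (LINT x|lborel. F (- x) * iexp (t * (- x)))"
        by (rule Bochner_Integration.integral_cnj)
      also have "(LINT x|lborel. F (- x) * iexp (t * (- x))) = ft F t"
        unfolding ft_def using lborel_integral_real_affine[of "-1" "\<lambda>x. F x * iexp (t * x)" 0] by simp
      finally show ?thesis .
    qed
    have "(LINT x|lborel. cnj (F x) * ft w (- x)) = (LINT x|lborel. v x * ft w x)"
      unfolding v_def using lborel_integral_real_affine[of "-1" "\<lambda>x. cnj (F x) * ft w (- x)" 0] by simp
    also have "\<dots> = (LINT t|lborel. ft v t * w t)"
      by (rule ft_multiplication_formula[OF v w])
    also have "\<dots> = (LINT t|lborel. complex_of_real ((norm (ft F t))\<^sup>2 * std_normal_density (e * t)))"
      unfolding ftv w_def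
      by (intro Bochner_Integration.integral_cong refl)
         (simp add: scaleR_conv_of_real complex_norm_square mult_ac del: of_real_power)
    also have "\<dots> = complex_of_real (LINT t|lborel. (norm (ft F t))\<^sup>2 * std_normal_density (e * t))"
      by (rule integral_complex_of_real)
    finally have *: "(LINT x|lborel. cnj (F x) * ft w (- x)) = \<dots>" .
    have "R e x = ft w (- x) / complex_of_real (sqrt (2 * pi))" for x
      using gauss_smoothing_eq_ft[OF F e, of x] unfolding R_def w_def by (simp add: field_simps)
    then have "(LINT x|lborel. cnj (F x) * R e x) = (LINT x|lborel. cnj (F x) * ft w (- x) / complex_of_real (sqrt (2 * pi)))"
      by simp
    also have "\<dots> = (LINT x|lborel. cnj (F x) * ft w (- x)) / complex_of_real (sqrt (2 * pi))"
      by (rule integral_divide_zero)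
    finally show ?thesis unfolding * by simp
  qed
  let ?e = "\<lambda>n. inverse (real (Suc n))"
  have lim: "(\<lambda>n. LINT x|lborel. cnj (F x) * R (?e n) x) \<longlonglongrightarrow> (LINT x|lborel. cnj (F x) * F x)"
  proof (rule integral_dominated_convergence[where w = "\<lambda>x. B * norm (F x)"])
    show "AE x in lborel. (\<lambda>n. cnj (F x) * R (?e n) x) \<longlonglongrightarrow> cnj (F x) * F x"
      unfolding R_def by (intro AE_I2 tendsto_intros gauss_smoothing_tendsto[OF cont B])
    show "AE x in lborel. norm (cnj (F x) * R (?e n) x) \<le> B * norm (F x)" for n
      using RB by (auto simp: norm_mult mult.commute[of B] intro!: mult_left_mono)
  qed (use F in auto)
  have FF: "cnj (F x) * F x = complex_of_real ((norm (F x))\<^sup>2)" for x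
    by (simp add: complex_norm_square mult.commute del: of_real_power)
  have lim': "(\<lambda>n. (LINT t|lborel. (norm (ft F t))\<^sup>2 * std_normal_density (?e n * t)) / sqrt (2 * pi))
     \<longlonglongrightarrow> (LINT x|lborel. (norm (F x))\<^sup>2)"
    using lim unfolding FF integral_complex_of_real by (subst (asm) id) (auto simp only: tendsto_of_real_iff, simp)
  have "(LINT x|lborel. (norm (F x))\<^sup>2) \<le> (LINT t|lborel. (norm (ft F t))\<^sup>2) / (2 * pi)"
  proof (rule LIMSEQ_le_const2[OF lim'], intro exI allI impI)
    fix n :: nat
    have "(LINT t|lborel. (norm (ft F t))\<^sup>2 * std_normal_density (?e n * t))
       \<le> (LINT t|lborel. (norm (ft F t))\<^sup>2 * (1 / sqrt (2 * pi)))"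
    proof (rule integral_mono')
      show "integrable lborel (\<lambda>t. (norm (ft F t))\<^sup>2 * (1 / sqrt (2 * pi)))"
        using sq by (rule integrable_mult_left)
      show "(norm (ft F t))\<^sup>2 * std_normal_density (?e n * t) \<le> (norm (ft F t))\<^sup>2 * (1 / sqrt (2 * pi))" for t
        by (intro mult_left_mono std_normal_density_le) simp
    qed simp
    also have "\<dots> = (LINT t|lborel. (norm (ft F t))\<^sup>2) / sqrt (2 * pi)"
      by simp
    finally have "(LINT t|lborel. (norm (ft F t))\<^sup>2 * std_normal_density (?e n * t)) / sqrt (2 * pi)
       \<le> (LINT t|lborel. (norm (ft F t))\<^sup>2) / sqrt (2 * pi) / sqrt (2 * pi)"
      by (rule divide_right_mono) simp
    then show "(LINT t|lborel. (norm (ft F t))\<^sup>2 * std_normal_density (?e n * t)) / sqrt (2 * pi)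
       \<le> (LINT t|lborel. (norm (ft F t))\<^sup>2) / (2 * pi)"
      unfolding divide_divide_eq_left by simp
  qed
  moreover have "L2norm_sq F = ennreal (LINT x|lborel. (norm (F x))\<^sup>2)"
    unfolding L2norm_sq_def
  proof (rule nn_integral_eq_integral)
    show "integrable lborel (\<lambda>x. (norm (F x))\<^sup>2)"
    proof (rule Bochner_Integration.integrable_bound)
      show "integrable lborel (\<lambda>x. B * norm (F x))" using F by auto
      show "AE x in lborel. norm ((norm (F x))\<^sup>2) \<le> norm (B * norm (F x))"
        using B B0 by (auto simp: power2_eq_square abs_mult intro!: mult_right_mono)
    qed simp
  qed simp
  ultimately show ?thesis by (simp add: ennreal_leI)
qed

section \<open>Derivatives of the kernel\<close>

lemma integrable_power_mult_gauss:
  assumes a: "a > 0"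
  shows "integrable lborel (\<lambda>x::real. x ^ k * exp (- (a * x)\<^sup>2 / 2))"
proof -
  have "integrable lborel (\<lambda>x. sqrt (2 * pi * (1 / a)\<^sup>2) * (normal_density 0 (1 / a) x * (x - 0) ^ k))"
    by (intro integrable_mult_right integrable_normal_moment) (use a in auto)
  moreover have "sqrt (2 * pi * (1 / a)\<^sup>2) * (normal_density 0 (1 / a) x * (x - 0) ^ k) = x ^ k * exp (- (a * x)\<^sup>2 / 2)" for x
    unfolding normal_density_def using a by (simp add: field_simps power_mult_distrib)
  ultimately show ?thesis by (simp only:)
qed

lemma integrable_poly_mult_gauss:
  assumes a: "a > 0"
  shows "integrable lborel (\<lambda>x::real. poly p x * exp (- (a * x)\<^sup>2 / 2))"
  unfolding poly_altdef sum_distrib_right mult.assoc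
  by (intro Bochner_Integration.integrable_sum integrable_mult_right integrable_power_mult_gauss a)

text \<open>With \<open>y = (a * x)\<^sup>2 / 2\<close> the known limit is that of
  \<open>y ^ k / exp y\<close>. For \<open>\<bar>x\<bar> \<ge> 1\<close> the power of
  \<open>\<bar>x\<bar>\<close> is at most the same power of
  \<open>x\<^sup>2 = y * (2 / a\<^sup>2)\<close>, whence the constant \<open>K\<close>.\<close>

lemma power_mult_gauss_tendsto_0:
  assumes a: "a > 0"
  shows "((\<lambda>x::real. x ^ k * exp (- (a * x)\<^sup>2 / 2)) \<longlongrightarrow> 0) at_infinity"
proof (rule tendsto_0_le[where K = "(2 / a\<^sup>2) ^ k"])
  have "filterlim (\<lambda>x::real. a\<^sup>2 / 2 * (norm x * norm x)) at_top at_infinity"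
    using a by (intro filterlim_tendsto_pos_mult_at_top[OF tendsto_const] filterlim_at_top_mult_at_top filterlim_norm_at_top) auto
  then have "filterlim (\<lambda>x. (a * x)\<^sup>2 / 2) at_top at_infinity"
    by (simp add: power2_eq_square mult_ac abs_mult_self_eq)
  from filterlim_compose[OF tendsto_power_div_exp_0 this]
  show "((\<lambda>x. ((a * x)\<^sup>2 / 2) ^ k / exp ((a * x)\<^sup>2 / 2)) \<longlongrightarrow> 0) at_infinity" .
  have "\<forall>\<^sub>F x::real in at_infinity. norm x \<ge> 1"
    unfolding eventually_at_infinity by auto
  then show "\<forall>\<^sub>F x in at_infinity. norm (x ^ k * exp (- (a * x)\<^sup>2 / 2))
      \<le> norm (((a * x)\<^sup>2 / 2) ^ k / exp ((a * x)\<^sup>2 / 2)) * (2 / a\<^sup>2) ^ k"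
  proof eventually_elim
    case (elim x)
    have "\<bar>x\<bar> * 1 \<le> \<bar>x\<bar> * \<bar>x\<bar>" using elim by (intro mult_left_mono) auto
    then have "\<bar>x\<bar> \<le> x\<^sup>2" by (simp add: power2_eq_square)
    then have "\<bar>x\<bar> ^ k \<le> (x\<^sup>2) ^ k" by (intro power_mono) auto
    also have "x\<^sup>2 = ((a * x)\<^sup>2 / 2) * (2 / a\<^sup>2)" using a by (simp add: power_mult_distrib)
    also have "\<dots> ^ k = ((a * x)\<^sup>2 / 2) ^ k * (2 / a\<^sup>2) ^ k" by (rule power_mult_distrib)
    finally have "\<bar>x\<bar> ^ k * exp (- (a * x)\<^sup>2 / 2) \<le> ((a * x)\<^sup>2 / 2) ^ k * (2 / a\<^sup>2) ^ k * exp (- (a * x)\<^sup>2 / 2)"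
      by (rule mult_right_mono) simp
    then show ?case by (simp add: abs_mult power_abs exp_minus field_simps)
  qed
qed

lemma poly_mult_gauss_tendsto_0:
  assumes a: "a > 0"
  shows "((\<lambda>x::real. poly p x * exp (- (a * x)\<^sup>2 / 2)) \<longlongrightarrow> 0) at_infinity"
  unfolding poly_altdef sum_distrib_right mult.assoc
  by (intro tendsto_null_sum tendsto_mult_right_zero power_mult_gauss_tendsto_0 a)

text \<open>Integration by parts: the derivative of \<open>F x * iexp (t * x)\<close> integrates to
  0 because \<open>F\<close> vanishes at both ends. The sign is negative since the transform uses
  the exponent \<open>\<i> * t * x\<close>.\<close>

lemma ft_vector_derivative:
  assumes deriv: "\<And>x. (F has_vector_derivative F' x) (at x)" and cont: "continuous_on UNIV F'"
    and F: "integrable lborel F" and F': "integrable lborel F'"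
    and top: "(F \<longlongrightarrow> 0) at_top" and bot: "(F \<longlongrightarrow> 0) at_bot"
  shows "ft F' t = - \<i> * complex_of_real t * ft F t"
proof -
  define G where "G x = F x * iexp (t * x)" for x
  define G' where "G' x = F' x * iexp (t * x) + \<i> * complex_of_real t * (F x * iexp (t * x))" for x
  have e: "((\<lambda>x. iexp (t * x)) has_vector_derivative \<i> * complex_of_real t * iexp (t * x)) (at x)" for x
  proof -
    have "((\<lambda>z. exp (\<i> * (complex_of_real t * z))) has_field_derivative \<i> * complex_of_real t * iexp (t * x)) (at (complex_of_real x))"
      by (auto intro!: derivative_eq_intros simp: mult_ac)
    from has_vector_derivative_real_field[OF this] show ?thesis by simp
  qed
  have G: "(G has_vector_derivative G' x) (at x)" for x
    unfolding G_def[abs_def] G'_def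
    by (rule has_vector_derivative_eq_rhs[OF has_vector_derivative_mult[OF deriv e]]) (simp add: algebra_simps)
  have contF: "continuous_on UNIV F"
    using deriv by (meson continuous_at_imp_continuous_on has_vector_derivative_continuous)
  have G'int: "integrable lborel G'"
    unfolding G'_def using integrable_mult_iexp[OF F] integrable_mult_iexp[OF F'] by auto
  have nG: "norm (G x) = norm (F x)" for x
    unfolding G_def by (simp add: norm_mult del: of_real_mult)
  have "(LBINT x=-\<infinity>..\<infinity>. G' x) = 0 - 0"
  proof (rule interval_integral_FTC_integrable[where F = G])
    have "continuous_on UNIV G'"
      unfolding G'_def using cont contF by (intro continuous_intros)
    then show "isCont G' x" for x by (simp add: continuous_on_eq_continuous_at)
    show "set_integrable lborel (einterval (- \<infinity>) \<infinity>) G'"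
      using G'int by (simp add: set_integrable_def einterval_def)
    show "((G \<circ> real_of_ereal) \<longlongrightarrow> 0) (at_right (- \<infinity>))"
      unfolding ereal_tendsto_simps by (rule tendsto_0_le[OF bot, where K = 1]) (simp add: nG)
    show "((G \<circ> real_of_ereal) \<longlongrightarrow> 0) (at_left \<infinity>)"
      unfolding ereal_tendsto_simps by (rule tendsto_0_le[OF top, where K = 1]) (simp add: nG)
  qed (use G in auto)
  then have "0 = (LINT x|lborel. G' x)"
    by (simp add: interval_lebesgue_integral_def set_lebesgue_integral_def einterval_def)
  also have "\<dots> = ft F' t + \<i> * complex_of_real t * ft F t"
    unfolding G'_def ft_def using integrable_mult_iexp[OF F, of t] integrable_mult_iexp[OF F', of t]
    by (subst Bochner_Integration.integral_add) (auto simp only: integral_mult_right_zero integrable_mult_right)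
  finally show ?thesis by (simp add: eq_neg_iff_add_eq_0)
qed

text \<open>Closed under differentiation, and large enough to contain the kernel \<open>H_scaled\<close>.\<close>

inductive gauss_span :: "real \<Rightarrow> (real \<Rightarrow> complex) \<Rightarrow> real \<Rightarrow> (real \<Rightarrow> complex) \<Rightarrow> bool" for a g d where
  base: "gauss_span a g d (\<lambda>x. (poly p x * exp (- (a * x)\<^sup>2 / 2)) *\<^sub>R nderiv i g (x / d))"
| add: "gauss_span a g d F \<Longrightarrow> gauss_span a g d G \<Longrightarrow> gauss_span a g d (\<lambda>x. F x + G x)"

lemma nderiv_0 [simp]: "nderiv 0 g = g"
  by (simp add: nderiv_def)

lemma nderiv_Suc: "nderiv (Suc j) g x = vector_derivative (nderiv j g) (at x)"
  by (simp add: nderiv_def)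

lemma smooth_has_vector_derivative:
  "smooth g \<Longrightarrow> (nderiv j g has_vector_derivative nderiv (Suc j) g x) (at x)"
  by (simp add: smooth_def nderiv_Suc vector_derivative_works)

lemma continuous_on_nderiv: "smooth g \<Longrightarrow> continuous_on UNIV (nderiv j g)"
  by (meson smooth_has_vector_derivative continuous_at_imp_continuous_on has_vector_derivative_continuous)

lemma gauss_span_deriv:
  assumes g: "smooth g" and d: "d \<noteq> 0" and "gauss_span a g d F"
  shows "\<exists>F'. gauss_span a g d F' \<and> (\<forall>x. (F has_vector_derivative F' x) (at x))"
  using assms(3)
proof induction
  case (base p i)
  let ?E = "\<lambda>x. exp (- (a * x)\<^sup>2 / 2)"
  \<comment> \<open>The Gaussian contributes the factor \<open>- a\<^sup>2 * x\<close> when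
    differentiated, and \<open>pCons 0 p\<close> is \<open>x\<close> times \<open>p\<close>.\<close>
  let ?q = "pderiv p - smult (a\<^sup>2) (pCons 0 p)"
  have "((\<lambda>x. (poly p x * ?E x) *\<^sub>R nderiv i g (x / d)) has_vector_derivative
      ((poly ?q x * ?E x) *\<^sub>R nderiv i g (x / d) + (poly (smult (1 / d) p) x * ?E x) *\<^sub>R nderiv (Suc i) g (x / d))) (at x)" for x
  proof -
    have "((\<lambda>x. poly p x * ?E x) has_field_derivative poly ?q x * ?E x) (at x)"
      by (auto intro!: derivative_eq_intros simp: algebra_simps power2_eq_square)
    moreover have "((\<lambda>x. nderiv i g (x / d)) has_vector_derivative (1 / d) *\<^sub>R nderiv (Suc i) g (x / d)) (at x)"
      by (rule vector_diff_chain_at[unfolded o_def, where f = "\<lambda>x. x / d"])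
         (auto intro!: derivative_eq_intros smooth_has_vector_derivative[OF g]
           simp: d simp flip: has_real_derivative_iff_has_vector_derivative)
    ultimately show ?thesis
      by (rule has_vector_derivative_eq_rhs[OF has_vector_derivative_scaleR]) (simp add: add.commute mult_ac)
  qed
  then show ?case
    by (intro exI[where x = "\<lambda>x. (poly ?q x * ?E x) *\<^sub>R nderiv i g (x / d) + (poly (smult (1 / d) p) x * ?E x) *\<^sub>R nderiv (Suc i) g (x / d)"]
          conjI allI gauss_span.add gauss_span.base)
next
  case (add F G)
  then obtain F' G' where "gauss_span a g d F'" "gauss_span a g d G'"
    and "\<And>x. (F has_vector_derivative F' x) (at x)" "\<And>x. (G has_vector_derivative G' x) (at x)"
    by blast
  then show ?case
    by (intro exI[where x = "\<lambda>x. F' x + G' x"] conjI allI gauss_span.add has_vector_derivative_add)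
qed

text \<open>Integrability comes from the Gaussian, which absorbs the polynomial; the derivatives of
  \<open>g\<close> enter only through their bounds.\<close>

lemma gauss_span_integrable:
  assumes g: "smooth g" and bdd: "\<And>i. \<exists>C. \<forall>x. norm (nderiv i g x) \<le> C" and a: "a > 0"
    and "gauss_span a g d F"
  shows "integrable lborel F"
  using assms(4)
proof induction
  case (base p i)
  obtain C where C: "\<And>x. norm (nderiv i g x) \<le> C" using bdd by blast
  have [measurable]: "nderiv i g \<in> borel_measurable borel"
    using continuous_on_nderiv[OF g] by (rule borel_measurable_continuous_onI)
  show ?case
    unfolding scaleR_conv_of_real
    by (intro integrable_mult_bounded[where C = C] integrable_of_real integrable_poly_mult_gauss a C) measurable
qed simp

lemma gauss_span_tendsto_0:
  assumes bdd: "\<And>i. \<exists>C. \<forall>x. norm (nderiv i g x) \<le> C" and a: "a > 0" and "gauss_span a g d F"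
  shows "(F \<longlongrightarrow> 0) at_infinity"
  using assms(3)
proof induction
  case (base p i)
  obtain C where C: "\<And>x. norm (nderiv i g x) \<le> C" using bdd by blast
  show ?case
    by (rule tendsto_0_le[OF poly_mult_gauss_tendsto_0[OF a], where K = C])
       (auto intro!: always_eventually mult_left_mono C)
next
  case (add F G)
  then show ?case using tendsto_add[of F 0 at_infinity G 0] by simp
qed

text \<open>Membership and the transform are proved in one induction: each integration by parts
  needs the current derivative to be integrable and to vanish at infinity, and membership gives
  both.\<close>

lemma gauss_span_nderiv:
  assumes g: "smooth g" and bdd: "\<And>i. \<exists>C. \<forall>x. norm (nderiv i g x) \<le> C" and a: "a > 0"
    and d: "d \<noteq> 0" and F: "gauss_span a g d F"
  shows "gauss_span a g d (nderiv j F) \<and> ft (nderiv j F) t = (- \<i> * complex_of_real t) ^ j * ft F t"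
proof (induction j)
  case 0
  then show ?case using F by simp
next
  case (Suc j)
  then obtain F' where F': "gauss_span a g d F'" and d': "\<And>x. (nderiv j F has_vector_derivative F' x) (at x)"
    using gauss_span_deriv[OF g d] by blast
  have eq: "nderiv (Suc j) F = F'"
    using d' by (auto simp: nderiv_Suc vector_derivative_at)
  \<comment> \<open>\<open>F'\<close> lies in the span again, so it is itself differentiable and
    hence continuous, as the fundamental theorem requires.\<close>
  have "continuous_on UNIV F'"
    using gauss_span_deriv[OF g d F'] by (meson continuous_at_imp_continuous_on has_vector_derivative_continuous)
  then have "ft F' t = - \<i> * complex_of_real t * ft (nderiv j F) t"
    using Suc F' gauss_span_integrable[OF g bdd a] gauss_span_tendsto_0[OF bdd a]
    by (intro ft_vector_derivative[OF d']) (meson tendsto_mono at_top_le_at_infinity at_bot_le_at_infinity)+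
  then show ?case using Suc F' eq by (simp add: mult_ac)
qed

text \<open>The decay at infinity controls the derivative outside a compact interval, continuity
  inside it.\<close>

lemma bourgain_cutoff_nderiv_bounded:
  assumes "bourgain_cutoff \<tau>"
  shows "\<exists>C. \<forall>x. norm (nderiv i (fourier \<tau>) x) \<le> C"
proof -
  let ?g = "nderiv i (fourier \<tau>)"
  have sm: "smooth (fourier \<tau>)"
    and decay: "\<forall>i. \<forall>\<nu>>0. (\<lambda>x. norm (nderiv i (fourier \<tau>) x)) \<in> O[at_infinity](\<lambda>x. \<bar>x\<bar> powr (- \<nu>))"
    using assms unfolding bourgain_cutoff_def by argo+
  have "(\<lambda>x. norm (?g x)) \<in> O[at_infinity](\<lambda>x. \<bar>x\<bar> powr (- 1))"
    using decay[rule_format, of 1 i] by simp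
  then obtain c where c: "c > 0" "\<forall>\<^sub>F x in at_infinity. norm (norm (?g x)) \<le> c * norm (\<bar>x\<bar> powr (- 1))"
    by (elim landau_o.bigE)
  then obtain b where b: "\<And>x. norm x \<ge> b \<Longrightarrow> norm (?g x) \<le> c * (\<bar>x\<bar> powr (- 1))"
    unfolding eventually_at_infinity by auto
  \<comment> \<open>The interval is widened to contain the unit interval so that
    \<open>\<bar>x\<bar> powr (- 1)\<close> is at most 1 outside.\<close>
  have "compact (?g ` {- max b 1..max b 1})"
    using continuous_on_nderiv[OF sm] by (intro compact_continuous_image) (auto intro: continuous_on_subset)
  then have "bounded (?g ` {- max b 1..max b 1})" by (rule compact_imp_bounded)
  then obtain B where B: "\<forall>x\<in>{- max b 1..max b 1}. norm (?g x) \<le> B"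
    unfolding bounded_iff by auto
  have "norm (?g x) \<le> max B c" for x
  proof (cases "\<bar>x\<bar> \<le> max b 1")
    case True
    then have "x \<in> {- max b 1..max b 1}" by auto
    with B have "norm (?g x) \<le> B" by blast
    then show ?thesis by simp
  next
    case False
    then have "norm (?g x) \<le> c * (\<bar>x\<bar> powr (- 1))" using b by auto
    also have "\<dots> \<le> c * 1" using False c by (intro mult_left_mono) (auto simp: powr_minus field_simps)
    finally show ?thesis by simp
  qed
  then show ?thesis by blast
qed

lemma gauss_span_H_scaled: "gauss_span (h / \<delta>) (fourier \<tau>) \<delta> (H_scaled \<tau> h \<delta>)"
proof -
  have *: "H_scaled \<tau> h \<delta> = (\<lambda>x. (poly [:1 / (2 * pi * \<delta>):] x * exp (- (h / \<delta> * x)\<^sup>2 / 2)) *\<^sub>R nderiv 0 (fourier \<tau>) (x / \<delta>))"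
    by (auto simp: fun_eq_iff H_scaled_def H_fun_def)
  show ?thesis unfolding * by (rule gauss_span.base)
qed

lemma
  assumes "bourgain_cutoff \<tau>" "h > 0" "\<delta> > 0"
  shows integrable_nderiv_H_scaled: "integrable lborel (nderiv j (H_scaled \<tau> h \<delta>))"
    and ft_nderiv_H_scaled:
      "ft (nderiv j (H_scaled \<tau> h \<delta>)) t = (- \<i> * complex_of_real t) ^ j * ft (H_scaled \<tau> h \<delta>) t"
proof -
  have sm: "smooth (fourier \<tau>)" using assms(1) by (simp add: bourgain_cutoff_def)
  have a: "h / \<delta> > 0" and d: "\<delta> \<noteq> 0" using assms by auto
  note bdd = bourgain_cutoff_nderiv_bounded[OF assms(1)]
  have *: "gauss_span (h / \<delta>) (fourier \<tau>) \<delta> (nderiv j (H_scaled \<tau> h \<delta>)) \<and>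
      ft (nderiv j (H_scaled \<tau> h \<delta>)) t = (- \<i> * complex_of_real t) ^ j * ft (H_scaled \<tau> h \<delta>) t"
    by (rule gauss_span_nderiv[OF sm bdd a d gauss_span_H_scaled])
  show "integrable lborel (nderiv j (H_scaled \<tau> h \<delta>))"
    by (rule gauss_span_integrable[OF sm bdd a conjunct1[OF *]])
  show "ft (nderiv j (H_scaled \<tau> h \<delta>)) t = (- \<i> * complex_of_real t) ^ j * ft (H_scaled \<tau> h \<delta>) t"
    by (rule conjunct2[OF *])
qed

section \<open>The transform of the kernel\<close>

lemma integrable_bourgain_cutoff:
  assumes "bourgain_cutoff \<tau>"
  shows "integrable lborel \<tau>"
proof (rule Bochner_Integration.integrable_bound)
  have \<tau>: "\<tau> \<in> borel_measurable borel" "\<And>u. 0 \<le> \<tau> u \<and> \<tau> u \<le> 1" "\<And>u. \<bar>u\<bar> > 17 / 15 \<Longrightarrow> \<tau> u = 0"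
    using assms by (auto simp: bourgain_cutoff_def)
  show "\<tau> \<in> borel_measurable lborel" using \<tau> by simp
  show "integrable lborel (indicator {- 2..2} :: real \<Rightarrow> real)" by simp
  show "AE u in lborel. norm (\<tau> u) \<le> norm (indicator {- 2..2} u :: real)"
  proof (rule AE_I2)
    fix u
    show "norm (\<tau> u) \<le> norm (indicator {- 2..2} u :: real)"
      using \<tau>(2,3)[of u] by (cases "u \<in> {- 2..2}") auto
  qed
qed

text \<open>Up to scaling, the kernel is a Gaussian times the transform of \<open>\<tau>\<close>.
  The multiplication formula moves the transform from \<open>\<tau>\<close> to the Gaussian, where
  the frequency \<open>t\<close> turns into the shift \<open>\<delta> * t\<close>. What remains is a
  real average of \<open>\<tau>\<close>.\<close>

lemma ft_H_scaled:
  assumes \<tau>: "bourgain_cutoff \<tau>" and h: "h > 0" and \<delta>: "\<delta> > 0"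
  shows "ft (H_scaled \<tau> h \<delta>) t = complex_of_real (LINT u|lborel. \<tau> u * gauss_kernel h (u + \<delta> * t))"
proof -
  define u where "u = (\<lambda>x. complex_of_real (std_normal_density (h * x)) * iexp (\<delta> * t * x))"
  have u: "integrable lborel u"
    unfolding u_def using h
    by (intro integrable_mult_iexp integrable_of_real integrable_std_normal_dilated) auto
  have "ft (H_scaled \<tau> h \<delta>) t = \<delta> *\<^sub>R (LINT x|lborel. H_scaled \<tau> h \<delta> (\<delta> * x) * iexp (t * (\<delta> * x)))"
    unfolding ft_def using \<delta> by (subst lborel_integral_real_affine[of \<delta> _ 0]) auto
  also have "\<dots> = (LINT x|lborel. \<delta> *\<^sub>R (H_scaled \<tau> h \<delta> (\<delta> * x) * iexp (t * (\<delta> * x))))"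
    by (rule integral_scaleR_right[symmetric])
  also have "\<dots> = (LINT x|lborel. complex_of_real (1 / sqrt (2 * pi)) * (u x * ft (\<lambda>x. of_real (\<tau> x)) x))"
  proof (rule Bochner_Integration.integral_cong[OF refl])
    fix x
    have "1 / (2 * pi) * exp (- ((h * x)\<^sup>2 / 2)) = 1 / sqrt (2 * pi) * std_normal_density (h * x)"
      by (simp add: std_normal_density_def)
    then have "\<delta> *\<^sub>R H_scaled \<tau> h \<delta> (\<delta> * x) = complex_of_real (1 / sqrt (2 * pi) * std_normal_density (h * x)) * ft (\<lambda>x. of_real (\<tau> x)) x"
      using \<delta> by (simp add: H_scaled_def H_fun_def fourier_eq_ft scaleR_conv_of_real)
    then show "\<delta> *\<^sub>R (H_scaled \<tau> h \<delta> (\<delta> * x) * iexp (t * (\<delta> * x)))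
        = complex_of_real (1 / sqrt (2 * pi)) * (u x * ft (\<lambda>x. of_real (\<tau> x)) x)"
      by (simp add: u_def mult_ac flip: scaleR_scaleR mult_scaleR_left)
  qed
  also have "\<dots> = complex_of_real (1 / sqrt (2 * pi)) * (LINT x|lborel. u x * ft (\<lambda>x. of_real (\<tau> x)) x)"
    by (rule integral_mult_right_zero)
  also have "(LINT x|lborel. u x * ft (\<lambda>x. of_real (\<tau> x)) x) = (LINT x|lborel. ft u x * of_real (\<tau> x))"
    by (intro ft_multiplication_formula u integrable_of_real integrable_bourgain_cutoff \<tau>)
  also have "\<dots> = (LINT x|lborel. complex_of_real (sqrt (2 * pi) * (\<tau> x * gauss_kernel h (x + \<delta> * t))))"
    unfolding u_def ft_modulated_gauss[OF h] by (simp add: mult_ac)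
  also have "\<dots> = complex_of_real (sqrt (2 * pi) * (LINT x|lborel. \<tau> x * gauss_kernel h (x + \<delta> * t)))"
    unfolding integral_complex_of_real integral_mult_right_zero ..
  finally show ?thesis by simp
qed

section \<open>Gaussian tails and the smoothed cutoff\<close>

lemma gauss_kernel_nonneg: "s > 0 \<Longrightarrow> 0 \<le> gauss_kernel s x"
  by (simp add: gauss_kernel_eq_normal_density)

lemma integrable_gauss_kernel_shift: "s > 0 \<Longrightarrow> integrable lborel (\<lambda>u. gauss_kernel s (u + x))"
  using lborel_integrable_real_affine[OF integrable_gauss_kernel, of s 1 x] by (simp add: add.commute)

lemma integral_gauss_kernel_shift: "s > 0 \<Longrightarrow> (LINT u|lborel. gauss_kernel s (u + x)) = 1"
  using lborel_integral_real_affine[of 1 "gauss_kernel s" x] integral_gauss_kernel[of s] by (simp add: add.commute)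

text \<open>Half of the exponent, \<open>v\<^sup>2 / (4 * s\<^sup>2)\<close>, is sacrificed for the
  small factor; the other half is again a Gaussian, of width \<open>sqrt 2 * s\<close>, so that
  integrating the bound over \<open>v\<close> costs only the factor \<open>sqrt 2\<close>.\<close>

lemma gauss_kernel_tail:
  assumes s: "s > 0" and a: "0 \<le> a" "a \<le> \<bar>v\<bar>"
  shows "gauss_kernel s v \<le> sqrt 2 * exp (- a\<^sup>2 / (4 * s\<^sup>2)) * gauss_kernel (sqrt 2 * s) v"
proof -
  have "a\<^sup>2 \<le> v\<^sup>2" using a by (metis abs_le_square_iff abs_of_nonneg)
  then have "exp (- v\<^sup>2 / (4 * s\<^sup>2)) \<le> exp (- a\<^sup>2 / (4 * s\<^sup>2))"
    using s by (auto intro!: divide_right_mono)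
  then have "exp (- v\<^sup>2 / (4 * s\<^sup>2)) * exp (- v\<^sup>2 / (4 * s\<^sup>2)) / (s * sqrt (2 * pi))
     \<le> exp (- a\<^sup>2 / (4 * s\<^sup>2)) * exp (- v\<^sup>2 / (4 * s\<^sup>2)) / (s * sqrt (2 * pi))"
    using s by (intro divide_right_mono mult_right_mono) auto
  moreover have "gauss_kernel s v = exp (- v\<^sup>2 / (4 * s\<^sup>2)) * exp (- v\<^sup>2 / (4 * s\<^sup>2)) / (s * sqrt (2 * pi))"
    using s by (simp add: gauss_kernel_def std_normal_density_def power_divide field_simps flip: exp_add)
  moreover have "sqrt 2 * gauss_kernel (sqrt 2 * s) v = exp (- v\<^sup>2 / (4 * s\<^sup>2)) / (s * sqrt (2 * pi))"
    using s by (simp add: gauss_kernel_def std_normal_density_def power_divide power_mult_distrib)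
  moreover have "sqrt 2 * exp (- a\<^sup>2 / (4 * s\<^sup>2)) * gauss_kernel (sqrt 2 * s) v
      = exp (- a\<^sup>2 / (4 * s\<^sup>2)) * (sqrt 2 * gauss_kernel (sqrt 2 * s) v)"
    by (simp only: mult_ac)
  ultimately show ?thesis by simp
qed

text \<open>The integral averages \<open>\<tau>\<close> against a probability density. The last
  bound collects the contribution of \<open>\<bar>u\<bar> \<ge> 1\<close>, where
  \<open>\<bar>u + s\<bar> \<ge> 1 / 2\<close>; the tail estimate with \<open>a = 1 / 2\<close>
  gives the 16.\<close>

lemma
  assumes \<tau>: "bourgain_cutoff \<tau>" and h: "h > 0"
  shows smoothed_cutoff_nonneg: "0 \<le> (LINT u|lborel. \<tau> u * gauss_kernel h (u + s))"
    and smoothed_cutoff_le_1: "(LINT u|lborel. \<tau> u * gauss_kernel h (u + s)) \<le> 1"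
    and smoothed_cutoff_ge:
      "\<bar>s\<bar> \<le> 1 / 2 \<Longrightarrow> 1 - (LINT u|lborel. \<tau> u * gauss_kernel h (u + s)) \<le> sqrt 2 * exp (- 1 / (16 * h\<^sup>2))"
proof -
  have [measurable]: "\<tau> \<in> borel_measurable borel" and b: "\<And>u. 0 \<le> \<tau> u" "\<And>u. \<tau> u \<le> 1" and one: "\<And>u. \<bar>u\<bar> < 1 \<Longrightarrow> \<tau> u = 1"
    using \<tau> by (auto simp: bourgain_cutoff_def)
  note gk = gauss_kernel_nonneg[OF h]
  note gi = integrable_gauss_kernel_shift[OF h, of s]
  have le: "\<tau> u * gauss_kernel h (u + s) \<le> gauss_kernel h (u + s)" for u
    using mult_right_mono[OF b(2) gk] by simp
  have int: "integrable lborel (\<lambda>u. \<tau> u * gauss_kernel h (u + s))"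
    by (rule Bochner_Integration.integrable_bound[OF gi]) (auto intro!: AE_I2 simp: b gk le)
  show "0 \<le> (LINT u|lborel. \<tau> u * gauss_kernel h (u + s))"
    by (intro Bochner_Integration.integral_nonneg) (auto intro!: mult_nonneg_nonneg b gk)
  have "(LINT u|lborel. \<tau> u * gauss_kernel h (u + s)) \<le> (LINT u|lborel. gauss_kernel h (u + s))"
    by (intro integral_mono int gi le)
  then show "(LINT u|lborel. \<tau> u * gauss_kernel h (u + s)) \<le> 1"
    using integral_gauss_kernel_shift[OF h] by simp
  show "1 - (LINT u|lborel. \<tau> u * gauss_kernel h (u + s)) \<le> sqrt 2 * exp (- 1 / (16 * h\<^sup>2))" if s: "\<bar>s\<bar> \<le> 1 / 2"
  proof -
    have h2: "sqrt 2 * h > 0" using h by simp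
    have "1 - (LINT u|lborel. \<tau> u * gauss_kernel h (u + s))
        = (LINT u|lborel. gauss_kernel h (u + s) - \<tau> u * gauss_kernel h (u + s))"
      by (subst Bochner_Integration.integral_diff[OF gi int]) (simp add: integral_gauss_kernel_shift[OF h])
    also have "\<dots> \<le> (LINT u|lborel. sqrt 2 * exp (- 1 / (16 * h\<^sup>2)) * gauss_kernel (sqrt 2 * h) (u + s))"
    proof (intro integral_mono Bochner_Integration.integrable_diff gi int integrable_mult_right integrable_gauss_kernel_shift h2)
      fix u
      show "gauss_kernel h (u + s) - \<tau> u * gauss_kernel h (u + s) \<le> sqrt 2 * exp (- 1 / (16 * h\<^sup>2)) * gauss_kernel (sqrt 2 * h) (u + s)"
      proof (cases "\<bar>u\<bar> < 1")
        case True
        then show ?thesis using one gauss_kernel_nonneg[OF h2] by simp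
      next
        case False
        then have "1 / 2 \<le> \<bar>u + s\<bar>" using s by (simp add: abs_if split: if_splits)
        from gauss_kernel_tail[OF h _ this]
        have "gauss_kernel h (u + s) \<le> sqrt 2 * exp (- 1 / (16 * h\<^sup>2)) * gauss_kernel (sqrt 2 * h) (u + s)"
          by (simp add: power_divide)
        moreover have "0 \<le> \<tau> u * gauss_kernel h (u + s)" by (intro mult_nonneg_nonneg b gk)
        ultimately show ?thesis by linarith
      qed
    qed
    also have "\<dots> = sqrt 2 * exp (- 1 / (16 * h\<^sup>2))"
      unfolding integral_mult_right_zero integral_gauss_kernel_shift[OF h2] by simp
    finally show ?thesis .
  qed
qed

text \<open>The logarithm in the bandwidth makes the exponential equal to \<open>\<sigma>\<close> to
  the power \<open>1 / (16 * c\<^sup>2)\<close>. The bound on \<open>c\<close> says that this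
  exponent is at least \<open>m\<^sup>2\<close>, and \<open>m \<ge> 2\<close> gives
  \<open>m\<^sup>2 \<ge> 2 * m\<close>.\<close>

lemma exp_bandwidth_h_le:
  assumes \<sigma>: "0 < \<sigma>" "\<sigma> < 1" and c: "0 < c" "c \<le> 1 / (4 * real m)" and m: "m \<ge> 2"
  shows "bandwidth_h c \<sigma> > 0" "exp (- 1 / (16 * (bandwidth_h c \<sigma>)\<^sup>2)) \<le> \<sigma> ^ (2 * m)"
proof -
  have l: "\<bar>ln \<sigma>\<bar> = - ln \<sigma>" "ln \<sigma> < 0" using \<sigma> by (auto simp: ln_less_zero)
  then show "bandwidth_h c \<sigma> > 0" using c by (simp add: bandwidth_h_def)
  have "(\<bar>ln \<sigma>\<bar> powr (- (1 / 2)))\<^sup>2 = 1 / (- ln \<sigma>)"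
    using l by (simp add: power2_eq_square powr_minus_divide flip: powr_add)
  then have eq: "- 1 / (16 * (bandwidth_h c \<sigma>)\<^sup>2) = ln \<sigma> * (1 / (16 * c\<^sup>2))"
    using l c by (simp add: bandwidth_h_def power_mult_distrib field_simps)
  have "4 * real m * c \<le> 1" using c m by (simp add: field_simps)
  then have "(4 * real m * c)\<^sup>2 \<le> 1" using c by (intro power_le_one) auto
  then have "(real m)\<^sup>2 \<le> 1 / (16 * c\<^sup>2)" using c by (simp add: field_simps power_mult_distrib)
  moreover have "real (2 * m) \<le> (real m)\<^sup>2" using m by (simp add: power2_eq_square)
  ultimately have "real (2 * m) \<le> 1 / (16 * c\<^sup>2)" by linarith
  then have "ln \<sigma> * (1 / (16 * c\<^sup>2)) \<le> ln \<sigma> * real (2 * m)"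
    using l by (intro mult_left_mono_neg) auto
  then have "exp (- 1 / (16 * (bandwidth_h c \<sigma>)\<^sup>2)) \<le> exp (real (2 * m) * ln \<sigma>)"
    unfolding eq by (simp add: mult.commute)
  also have "\<dots> = \<sigma> ^ (2 * m)" unfolding exp_of_nat_mult using \<sigma> by simp
  finally show "exp (- 1 / (16 * (bandwidth_h c \<sigma>)\<^sup>2)) \<le> \<sigma> ^ (2 * m)" .
qed

text \<open>The Laplace density is, away from 0, a sum of two such exponentials, one of them
  reflected. The antiderivative is \<open>- exp (- s * x) / s\<close>.\<close>

lemma
  fixes s :: complex
  assumes s: "Re s > 0"
  shows integrable_exp_half_line: "integrable lborel (\<lambda>x. indicator {0<..} x *\<^sub>R exp (- s * complex_of_real x))"
    and integral_exp_half_line: "(LINT x|lborel. indicator {0<..} x *\<^sub>R exp (- s * complex_of_real x)) = 1 / s"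
proof -
  let ?f = "\<lambda>x. exp (- s * complex_of_real x)"
  have "integrable lborel (\<lambda>x::real. x ^ 0 * exp (- x) * indicator {0..} x)"
    using has_bochner_integral_I0i_power_exp_m'[of 0] by (rule integrable.intros)
  from lborel_integrable_real_affine[OF this, of "Re s" 0] s
  have "integrable lborel (\<lambda>x. exp (- (Re s * x)) * indicator {0..} (Re s * x))" by simp
  then show int: "integrable lborel (\<lambda>x. indicator {0<..} x *\<^sub>R ?f x)"
    by (rule Bochner_Integration.integrable_bound)
       (use s in \<open>auto intro!: AE_I2 simp: indicator_def\<close>)
  have "(LBINT x=0..\<infinity>. ?f x) = 0 - (- 1 / s)"
  proof (rule interval_integral_FTC_integrable[where F = "\<lambda>x. - ?f x / s"])
    show "((\<lambda>x. - ?f x / s) has_vector_derivative ?f x) (at x)" for x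
    proof -
      have "((\<lambda>z. - exp (- s * z) / s) has_field_derivative ?f x) (at (complex_of_real x))"
        using s by (auto intro!: derivative_eq_intros)
      from has_vector_derivative_real_field[OF this] show ?thesis .
    qed
    show "set_integrable lborel (einterval 0 \<infinity>) ?f"
      using int by (simp add: set_integrable_def einterval_def greaterThan_def zero_ereal_def)
    have lim0: "((\<lambda>x. - ?f x / s) \<longlongrightarrow> - 1 / s) (at_right 0)"
      by (rule filterlim_mono[OF _ order_refl at_le[OF subset_UNIV]])
         (use s in \<open>auto intro!: tendsto_eq_intros\<close>)
    then show "(((\<lambda>x. - ?f x / s) \<circ> real_of_ereal) \<longlongrightarrow> - 1 / s) (at_right 0)"
      unfolding zero_ereal_def ereal_tendsto_simps .
    have "((\<lambda>x. exp (- (Re s * x))) \<longlongrightarrow> 0) at_top"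
      using s by (intro filterlim_compose[OF exp_at_bot] filterlim_uminus_at_bot_at_top[THEN filterlim_compose]
          filterlim_tendsto_pos_mult_at_top[OF tendsto_const] filterlim_ident) auto
    then show "(((\<lambda>x. - ?f x / s) \<circ> real_of_ereal) \<longlongrightarrow> 0) (at_left \<infinity>)"
      unfolding ereal_tendsto_simps
      by (rule tendsto_0_le[where K = "1 / norm s"]) (simp add: norm_divide)
  qed auto
  then have "(LBINT x=0..\<infinity>. ?f x) = 1 / s" by simp
  then show "(LINT x|lborel. indicator {0<..} x *\<^sub>R ?f x) = 1 / s"
    by (simp add: interval_lebesgue_integral_def set_lebesgue_integral_def einterval_def greaterThan_def zero_ereal_def)
qed

section \<open>Bounds on the multipliers\<close>

lemma norm_sum_exp_series_le: "norm (\<Sum>k\<in>I. (z :: complex) ^ k / fact k) \<le> exp (norm z)" if "finite I"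
proof -
  have "norm (\<Sum>k\<in>I. z ^ k / fact k) \<le> (\<Sum>k\<in>I. norm z ^ k / fact k)"
    by (rule order_trans[OF norm_sum]) (simp add: norm_divide norm_power)
  also have "\<dots> \<le> (\<Sum>k. norm z ^ k / fact k)"
    using summable_exp[of "norm z"] that by (intro sum_le_suminf) (auto simp: field_simps)
  also have "\<dots> = exp (norm z)" by (simp add: exp_def field_simps)
  finally show ?thesis .
qed

lemma exp_remainder_le:
  fixes z :: complex
  assumes "m \<ge> 1"
  shows "norm (exp z - (1 + (\<Sum>k\<in>{1..<m}. z ^ k / fact k))) \<le> exp (norm z) * norm z ^ m"
proof -
  obtain n where m: "m = Suc n" using assms by (cases m) auto
  \<comment> \<open>\<open>Taylor_exp\<close> sums up to \<open>n\<close> inclusive, which is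
    \<open>m - 1\<close>; its remainder therefore has the power \<open>m\<close>.\<close>
  have "1 + (\<Sum>k\<in>{1..<m}. z ^ k / fact k) = (\<Sum>k\<le>n. z ^ k / fact k)"
    unfolding m atMost_atLeast0 sum.atLeast_Suc_atMost[OF le0] by (simp add: atLeastLessThanSuc_atLeastAtMost)
  then have "norm (exp z - (1 + (\<Sum>k\<in>{1..<m}. z ^ k / fact k))) \<le> exp \<bar>Re z\<bar> * norm z ^ m / fact n"
    using Taylor_exp[of z n] m by simp
  also have "\<dots> \<le> exp \<bar>Re z\<bar> * norm z ^ m / 1"
    by (intro divide_left_mono) auto
  also have "\<dots> \<le> exp (norm z) * norm z ^ m"
    using abs_Re_le_cmod[of z] by (auto intro!: mult_right_mono)
  finally show ?thesis .
qed

lemma exp_le_3: "x \<le> 1 \<Longrightarrow> exp x \<le> (3 :: real)"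
  using exp_le exp_le_cancel_iff order_trans by blast

text \<open>For \<open>\<sigma>\<bar>t\<bar> \<le> 1 / 2\<close> the truncated exponential series nearly inverts \<open>exp z\<close>; beyond, the
  multiplier is merely bounded, since \<open>Re z + norm z = \<sigma>\<^sup>2 / 4\<close>.\<close>

lemma multiplier_bound:
  fixes \<sigma> t b E \<alpha> :: real and m :: nat
  defines "z \<equiv> (complex_of_real \<sigma>)\<^sup>2 * (complex_of_real b + \<i> * complex_of_real t)\<^sup>2 / 2"
  assumes \<sigma>: "0 < \<sigma>" "\<sigma> < 1" and b: "b\<^sup>2 = 1 / 4" and m: "m \<ge> 1" and \<alpha>: "0 \<le> \<alpha> + 2" "\<alpha> + 2 \<le> 2 * real m"
    and E: "0 \<le> E" "E \<le> 1" and E_close: "\<sigma> * \<bar>t\<bar> \<le> 1 / 2 \<Longrightarrow> 1 - E \<le> sqrt 2 * \<sigma> ^ (2 * m)"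
  shows "norm (exp z * (1 + (\<Sum>k\<in>{1..<m}. (- z) ^ k / fact k) * complex_of_real E) - 1)
    \<le> 27 * 2 ^ (2 * m) * (\<sigma> * (1 + \<bar>t\<bar>)) powr (\<alpha> + 2)"
proof -
  define \<rho> where "\<rho> = \<sigma> * (1 + \<bar>t\<bar>)"
  define S where "S = (\<Sum>k\<in>{1..<m}. (- z) ^ k / fact k)"
  have \<rho>0: "\<rho> > 0" unfolding \<rho>_def using \<sigma> by (intro mult_pos_pos) auto
  have "norm (complex_of_real b + \<i> * complex_of_real t) ^ 2 = 1 / 4 + t\<^sup>2"
    by (simp add: cmod_power2 b)
  then have nz: "norm z = \<sigma>\<^sup>2 * (1 / 4 + t\<^sup>2) / 2"
    unfolding z_def by (simp add: norm_mult norm_divide norm_power)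
  have "z = complex_of_real (\<sigma>\<^sup>2 * (b\<^sup>2 - t\<^sup>2) / 2) + \<i> * complex_of_real (\<sigma>\<^sup>2 * b * t)"
    unfolding z_def by (simp add: complex_eq_iff power2_eq_square algebra_simps)
  then have Rez: "Re z = \<sigma>\<^sup>2 * (1 / 4 - t\<^sup>2) / 2"
    using b by simp
  show ?thesis
  proof (cases "\<sigma> * \<bar>t\<bar> \<le> 1 / 2")
    case True
    have s1: "\<sigma>\<^sup>2 \<le> 1" using \<sigma> by (intro power_le_one) auto
    have "(\<sigma> * \<bar>t\<bar>)\<^sup>2 \<le> (1 / 2)\<^sup>2" using True \<sigma> by (intro power_mono) auto
    then have "\<sigma>\<^sup>2 * t\<^sup>2 \<le> 1 / 4" by (simp add: power_mult_distrib power_divide)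
    then have nz1: "norm z \<le> 1" unfolding nz using s1 by (simp add: algebra_simps)
    have \<rho>2: "\<rho> \<le> 2" unfolding \<rho>_def using True \<sigma> by (simp add: algebra_simps)
    have "1 / 4 + t\<^sup>2 \<le> (1 + \<bar>t\<bar>)\<^sup>2" by (simp add: power2_sum)
    then have "\<sigma>\<^sup>2 * (1 / 4 + t\<^sup>2) \<le> \<sigma>\<^sup>2 * (1 + \<bar>t\<bar>)\<^sup>2"
      by (rule mult_left_mono) simp
    moreover have "0 \<le> \<sigma>\<^sup>2 * (1 / 4 + t\<^sup>2)" by (intro mult_nonneg_nonneg add_nonneg_nonneg) auto
    moreover have "y / 2 \<le> x" if "y \<le> x" "0 \<le> y" for x y :: real using that by simp
    ultimately have "norm z \<le> \<sigma>\<^sup>2 * (1 + \<bar>t\<bar>)\<^sup>2"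
      unfolding nz by blast
    then have "norm z \<le> \<rho>\<^sup>2" by (simp add: \<rho>_def power_mult_distrib)
    then have zm: "norm z ^ m \<le> \<rho> ^ (2 * m)"
      unfolding power_mult by (intro power_mono) auto
    have ez: "norm (exp z) \<le> 3"
      using nz1 norm_exp[of z] exp_le_3[OF nz1] by linarith
    have r: "norm ((1 + S) - exp (- z)) \<le> 3 * \<rho> ^ (2 * m)"
    proof -
      have "norm ((1 + S) - exp (- z)) = norm (exp (- z) - (1 + S))" by (rule norm_minus_commute)
      also have "\<dots> \<le> exp (norm z) * norm z ^ m"
        using exp_remainder_le[OF m, of "- z"] unfolding S_def by simp
      also have "\<dots> \<le> 3 * \<rho> ^ (2 * m)"
        by (intro mult_mono exp_le_3 nz1 zm) auto
      finally show ?thesis .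
    qed
    have S3: "norm S \<le> 3"
      using norm_sum_exp_series_le[of "{1..<m}" "- z"] exp_le_3[OF nz1] unfolding S_def by simp
    have "\<sigma> \<le> \<rho>" unfolding \<rho>_def using \<sigma> by simp
    then have sr: "\<sigma> ^ (2 * m) \<le> \<rho> ^ (2 * m)" using \<sigma> by (intro power_mono) auto
    have "sqrt 2 \<le> 2" by (simp add: real_le_rsqrt real_sqrt_le_iff real_le_lsqrt)
    then have "sqrt 2 * \<sigma> ^ (2 * m) \<le> 2 * \<rho> ^ (2 * m)" using sr \<sigma> by (intro mult_mono) auto
    then have E1: "\<bar>E - 1\<bar> \<le> 2 * \<rho> ^ (2 * m)" using E E_close[OF True] by simp
    \<comment> \<open>The first term is the error of truncating the series of
      \<open>exp (- z)\<close>, the second the error of the cutoff.\<close>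
    have "exp z * (1 + S * complex_of_real E) - 1
        = exp z * ((1 + S) - exp (- z)) + exp z * (S * complex_of_real (E - 1))"
      by (simp add: algebra_simps flip: exp_add)
    then have "norm (exp z * (1 + S * complex_of_real E) - 1)
        \<le> norm (exp z) * norm ((1 + S) - exp (- z)) + norm (exp z) * (norm S * \<bar>E - 1\<bar>)"
      by (metis norm_mult norm_of_real norm_triangle_ineq)
    \<comment> \<open>Each 3 bounds an exponential of a number of modulus at most 1, and the 2 comes
      from \<open>sqrt 2 \<le> 2\<close>; in all \<open>9 + 18 = 27\<close>.\<close>
    also have "\<dots> \<le> 3 * (3 * \<rho> ^ (2 * m)) + 3 * (3 * (2 * \<rho> ^ (2 * m)))"
      by (intro add_mono mult_mono ez r S3 E1) (auto simp: \<rho>0 less_imp_le)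
    also have "\<dots> = 27 * \<rho> ^ (2 * m)" by simp
    \<comment> \<open>The surplus exponent is nonnegative by the lower bound on \<open>m\<close>,
      and \<open>\<rho> \<le> 2\<close> lets it cost at most \<open>2 ^ (2 * m)\<close>.\<close>
    also have "\<rho> ^ (2 * m) = \<rho> powr (2 * real m - (\<alpha> + 2)) * \<rho> powr (\<alpha> + 2)"
      using \<rho>0 powr_realpow[OF \<rho>0, of "2 * m"] by (simp flip: powr_add)
    also have "\<dots> \<le> 2 ^ (2 * m) * \<rho> powr (\<alpha> + 2)"
    proof (intro mult_right_mono)
      have "\<rho> powr (2 * real m - (\<alpha> + 2)) \<le> 2 powr (2 * real m - (\<alpha> + 2))"
        using \<rho>0 \<rho>2 \<alpha> by (intro powr_mono2) auto
      also have "\<dots> \<le> 2 powr (real (2 * m))" using \<alpha> by (intro powr_mono) auto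
      finally show "\<rho> powr (2 * real m - (\<alpha> + 2)) \<le> 2 ^ (2 * m)" by (simp only: powr_realpow zero_less_numeral)
    qed simp
    finally show ?thesis unfolding \<rho>_def S_def by simp
  next
    case False
    have "Re z + norm z = \<sigma>\<^sup>2 / 4" unfolding Rez nz by (simp add: field_simps)
    also have "\<dots> \<le> 1 / 4" using \<sigma> by (simp add: power_le_one)
    finally have le: "Re z + norm z \<le> 1 / 4" .
    then have e: "exp (Re z) * exp (norm z) \<le> 3"
      using exp_le_3[of "Re z + norm z"] by (simp add: exp_add)
    have e': "exp (Re z) \<le> 3"
      using exp_le_3[of "Re z"] le norm_ge_zero[of z] by linarith
    have "norm (exp z * (1 + S * complex_of_real E) - 1) \<le> norm (exp z + exp z * (S * complex_of_real E)) + 1"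
      using norm_triangle_ineq4[of "exp z + exp z * (S * complex_of_real E)" 1] by (simp add: algebra_simps)
    also have "\<dots> \<le> norm (exp z) + norm (exp z) * (norm S * E) + 1"
      using norm_triangle_ineq[of "exp z" "exp z * (S * complex_of_real E)"] E by (simp add: norm_mult)
    also have "norm (exp z) * (norm S * E) \<le> exp (Re z) * (exp (norm z) * 1)"
      using norm_sum_exp_series_le[of "{1..<m}" "- z"] E unfolding S_def
      by (intro mult_mono) auto
    \<comment> \<open>\<open>7 = 3 + 3 + 1\<close>. Since
      \<open>\<sigma> * \<bar>t\<bar> > 1 / 2\<close> forces \<open>2 * \<rho> \<ge> 1\<close>, this
      constant is absorbed by a power of \<open>2 * \<rho>\<close>.\<close>
    finally have "norm (exp z * (1 + S * complex_of_real E) - 1) \<le> 7"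
      using e e' by simp
    also have "7 \<le> 27 * (2 * \<rho>) powr (\<alpha> + 2)"
    proof -
      have "1 \<le> 2 * \<rho>" unfolding \<rho>_def using False \<sigma> by (simp add: algebra_simps)
      then have "1 \<le> (2 * \<rho>) powr (\<alpha> + 2)" using \<alpha> by (intro ge_one_powr_ge_zero) auto
      then show ?thesis by simp
    qed
    also have "\<dots> \<le> 27 * (2 ^ (2 * m) * \<rho> powr (\<alpha> + 2))"
    proof -
      have "2 powr (\<alpha> + 2) \<le> 2 powr (real (2 * m))" using \<alpha> by (intro powr_mono) auto
      also have "\<dots> = 2 ^ (2 * m)" by (simp only: powr_realpow zero_less_numeral)
      finally have "2 powr (\<alpha> + 2) \<le> (2 :: real) ^ (2 * m)" .
      then show ?thesis using \<rho>0 by (simp add: powr_mult mult_right_mono)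
    qed
    finally show ?thesis unfolding \<rho>_def S_def by simp
  qed
qed

text \<open>Splitting at 0 gives the transform as \<open>1 / (s1 t * s2 t)\<close>. For
  \<open>\<bar>b\<bar> \<le> 1 / 2\<close> both factors have real part at least
  \<open>1 / 2\<close>, so each grows like \<open>1 + \<bar>t\<bar>\<close>.\<close>

lemma norm_fourier_tilted_laplace_le:
  assumes "\<bar>b\<bar> \<le> 1 / 2"
  shows "integrable lborel (\<lambda>x. exp (b * x) * laplace_density x)"
    and "norm (fourier (\<lambda>x. exp (b * x) * laplace_density x) t) \<le> 8 / (1 + \<bar>t\<bar>)\<^sup>2"
proof -
  define s1 where "s1 u = complex_of_real (1 - b) - \<i> * complex_of_real u" for u
  define s2 where "s2 u = complex_of_real (1 + b) + \<i> * complex_of_real u" for u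
  let ?g1 = "\<lambda>u x. indicator {0<..} x *\<^sub>R exp (- s1 u * complex_of_real x)"
  let ?g2 = "\<lambda>u x. indicator {0<..} (- x) *\<^sub>R exp (- s2 u * complex_of_real (- x))"
  have Re: "Re (s1 u) > 0" "Re (s2 u) > 0" for u using assms by (auto simp: s1_def s2_def)
  have g1: "integrable lborel (?g1 u)" "(LINT x|lborel. ?g1 u x) = 1 / s1 u" for u
    using integrable_exp_half_line integral_exp_half_line Re by blast+
  have g2: "integrable lborel (?g2 u)" "(LINT x|lborel. ?g2 u x) = 1 / s2 u" for u
    using lborel_integrable_real_affine[OF integrable_exp_half_line[OF Re(2)[of u]], of "-1" 0]
      lborel_integral_real_affine[of "-1" "\<lambda>x. indicator {0<..} x *\<^sub>R exp (- s2 u * complex_of_real x)" 0]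
      integral_exp_half_line[OF Re(2)[of u]]
    by simp_all
  have meas: "(\<lambda>x. (exp (b * x) * laplace_density x) *\<^sub>R iexp (u * x)) \<in> borel_measurable borel" for u
    unfolding laplace_density_def by measurable
  \<comment> \<open>The equality fails at 0, where both open half-lines give 0.\<close>
  have eq: "AE x in lborel. (exp (b * x) * laplace_density x) *\<^sub>R iexp (u * x) = (1 / 2) *\<^sub>R (?g1 u x + ?g2 u x)" for u
    using AE_lborel_singleton[of 0]
  proof eventually_elim
    case (elim x)
    then consider "x > 0" | "x < 0" by linarith
    then show ?case
      by cases (auto simp: laplace_density_def s1_def s2_def scaleR_conv_of_real exp_of_real[symmetric] algebra_simps
           simp flip: exp_add)
  qed
  have int: "integrable lborel (\<lambda>x. (1 / 2) *\<^sub>R (?g1 u x + ?g2 u x))" for u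
    using g1 g2 by auto
  have "integrable lborel (\<lambda>x. (exp (b * x) * laplace_density x) *\<^sub>R iexp (0 * x))"
    using int[of 0] by (subst integrable_cong_AE[OF _ _ eq[of 0]]) (use meas[of 0] in auto)
  then have "integrable lborel (\<lambda>x. complex_of_real (exp (b * x) * laplace_density x))"
    by (simp add: scaleR_conv_of_real)
  then show "integrable lborel (\<lambda>x. exp (b * x) * laplace_density x)"
    using complex_of_real_integrable_eq by blast
  have "fourier (\<lambda>x. exp (b * x) * laplace_density x) t = (LINT x|lborel. (1 / 2) *\<^sub>R (?g1 t x + ?g2 t x))"
    unfolding fourier_def using int[of t] by (intro integral_cong_AE eq) (use meas[of t] in auto)
  also have "\<dots> = (1 / 2) *\<^sub>R (1 / s1 t + 1 / s2 t)"
    using g1[of t] g2[of t] by (subst integral_scaleR_right, subst Bochner_Integration.integral_add) simp_all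
  also have "1 / s1 t + 1 / s2 t = 2 / (s1 t * s2 t)"
  proof -
    have "s1 t \<noteq> 0" "s2 t \<noteq> 0" using Re[of t] by auto
    moreover have "s1 t + s2 t = 2" by (simp add: s1_def s2_def)
    ultimately show ?thesis by (simp add: field_simps)
  qed
  finally have "norm (fourier (\<lambda>x. exp (b * x) * laplace_density x) t) = 1 / (norm (s1 t) * norm (s2 t))"
    by (simp add: norm_divide norm_mult)
  also have "\<dots> \<le> 8 / (1 + \<bar>t\<bar>)\<^sup>2"
  proof -
    \<comment> \<open>The 8 comes from \<open>(1 + \<bar>t\<bar>)\<^sup>2 \<le> 2 + 2 * t\<^sup>2
      \<le> 8 * (1 / 4 + t\<^sup>2)\<close>.\<close>
    have half: "(1 + \<bar>t\<bar>) / sqrt 8 \<le> norm s"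
      if "\<bar>Re s\<bar> \<ge> 1 / 2" "\<bar>Im s\<bar> = \<bar>t\<bar>" for s :: complex
    proof -
      have "(1 / 2)\<^sup>2 \<le> \<bar>Re s\<bar>\<^sup>2" using that by (intro power_mono) auto
      then have "1 / 4 \<le> (Re s)\<^sup>2" by (simp add: power_divide)
      moreover have "(Im s)\<^sup>2 = t\<^sup>2" using that by (metis power2_abs)
      moreover have "0 \<le> (\<bar>t\<bar> - 1)\<^sup>2" by simp
      then have "2 * \<bar>t\<bar> \<le> 1 + t\<^sup>2" by (simp add: power2_diff)
      moreover have "(1 + \<bar>t\<bar>)\<^sup>2 = 1 + 2 * \<bar>t\<bar> + t\<^sup>2" by (simp add: power2_sum)
      moreover have "0 \<le> t\<^sup>2" by simp
      moreover have "X \<le> 8 * (R + I)"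
        if "1 / 4 \<le> R" "I = T" "2 * a \<le> 1 + T" "X = 1 + 2 * a + T" "0 \<le> T" for X R I T a :: real
        using that by (simp add: algebra_simps)
      ultimately have "(1 + \<bar>t\<bar>)\<^sup>2 \<le> 8 * (norm s)\<^sup>2"
        unfolding cmod_power2 by blast
      then have "((1 + \<bar>t\<bar>) / sqrt 8)\<^sup>2 \<le> (norm s)\<^sup>2" by (simp add: power_divide)
      then show ?thesis by (rule power2_le_imp_le) simp
    qed
    have "(1 + \<bar>t\<bar>) / sqrt 8 * ((1 + \<bar>t\<bar>) / sqrt 8) \<le> norm (s1 t) * norm (s2 t)"
      using assms by (intro mult_mono half) (auto simp: s1_def s2_def)
    then have *: "(1 + \<bar>t\<bar>)\<^sup>2 / 8 \<le> norm (s1 t) * norm (s2 t)" by (simp add: power2_eq_square)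
    have "1 / (norm (s1 t) * norm (s2 t)) \<le> 1 / ((1 + \<bar>t\<bar>)\<^sup>2 / 8)"
      by (rule divide_left_mono[OF *]) (use Re[of t] in \<open>auto intro!: mult_pos_pos add_pos_nonneg\<close>)
    then show ?thesis by simp
  qed
  finally show "norm (fourier (\<lambda>x. exp (b * x) * laplace_density x) t) \<le> 8 / (1 + \<bar>t\<bar>)\<^sup>2" .
qed

section \<open>Exponential tilting\<close>

lemma exp_conv_tilt:
  "exp (b * x) *\<^sub>R conv f g x = conv (\<lambda>u. exp (b * u) * f u) (\<lambda>y. exp (b * y) *\<^sub>R g y) x"
proof -
  have "exp (b * x) *\<^sub>R conv f g x = (LINT y|lborel. exp (b * x) *\<^sub>R (f (x - y) *\<^sub>R g y))"
    unfolding conv_def by (rule integral_scaleR_right[symmetric])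
  also have "\<dots> = conv (\<lambda>u. exp (b * u) * f u) (\<lambda>y. exp (b * y) *\<^sub>R g y) x"
    unfolding conv_def
  proof (rule Bochner_Integration.integral_cong[OF refl])
    fix y
    have "exp (b * x) = exp (b * (x - y)) * exp (b * y)"
      by (simp add: algebra_simps flip: exp_add)
    then show "exp (b * x) *\<^sub>R (f (x - y) *\<^sub>R g y) = (exp (b * (x - y)) * f (x - y)) *\<^sub>R (exp (b * y) *\<^sub>R g y)"
      by simp
  qed
  finally show ?thesis .
qed

text \<open>Boundedness and continuity pass from \<open>f\<close> to the convolution even if
  \<open>g\<close> is merely integrable. With the tilted Laplace density as \<open>f\<close>, this
  supplies the hypotheses of the Plancherel inequality.\<close>

lemma
  assumes cont: "continuous_on UNIV f" and B: "\<And>x. \<bar>f x\<bar> \<le> B" and g: "integrable lborel g"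
  shows continuous_on_conv: "continuous_on UNIV (conv f g)"
    and norm_conv_le: "norm (conv f g x) \<le> B * (LINT y|lborel. norm (g y))"
proof -
  have [measurable]: "f \<in> borel_measurable borel" "g \<in> borel_measurable borel"
    using cont g by (auto intro: borel_measurable_continuous_onI)
  have le: "norm (f u *\<^sub>R g y) \<le> B * norm (g y)" for u y
    using B[of u] by (auto intro: mult_right_mono)
  have int: "integrable lborel (\<lambda>y. B * norm (g y))" using g by auto
  show "continuous_on UNIV (conv f g)"
    unfolding continuous_on_eq_continuous_at[OF open_UNIV]
  proof (intro ballI continuous_at_sequentiallyI)
    fix x :: real and u :: "nat \<Rightarrow> real"
    assume u: "u \<longlonglongrightarrow> x"
    show "(\<lambda>n. conv f g (u n)) \<longlonglongrightarrow> conv f g x"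
      unfolding conv_def
    proof (rule integral_dominated_convergence[where w = "\<lambda>y. B * norm (g y)"])
      show "AE y in lborel. (\<lambda>n. f (u n - y) *\<^sub>R g y) \<longlonglongrightarrow> f (x - y) *\<^sub>R g y"
      proof (rule AE_I2)
        fix y
        have "isCont f (x - y)" using cont by (simp add: continuous_on_eq_continuous_at)
        then have "(\<lambda>n. f (u n - y)) \<longlonglongrightarrow> f (x - y)"
          using u by (intro isCont_tendsto_compose[where g = f] tendsto_intros)
        then show "(\<lambda>n. f (u n - y) *\<^sub>R g y) \<longlonglongrightarrow> f (x - y) *\<^sub>R g y"
          by (intro tendsto_intros)
      qed
    qed (use int le in auto)
  qed
  have "norm (conv f g x) \<le> (LINT y|lborel. norm (f (x - y) *\<^sub>R g y))"
    unfolding conv_def by (rule integral_norm_bound)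
  also have "\<dots> \<le> (LINT y|lborel. B * norm (g y))"
  proof (rule integral_mono'[OF int le])
    show "0 \<le> B * norm (g y)" for y
      using B[of 0] by (intro mult_nonneg_nonneg) auto
  qed
  finally show "norm (conv f g x) \<le> B * (LINT y|lborel. norm (g y))" by simp
qed

text \<open>Completing the square: the tilt shifts the Gaussian by \<open>b * s\<^sup>2\<close> and
  multiplies it by \<open>exp (b\<^sup>2 * s\<^sup>2 / 2)\<close>. The transform is the Gaussian
  moment generating function at the complex point \<open>b + \<i> * t\<close>.\<close>

lemma
  assumes "s > 0"
  shows integrable_tilted_gauss: "integrable lborel (\<lambda>x. exp (b * x) * gauss_kernel s x)"
    and fourier_tilted_gauss: "fourier (\<lambda>x. exp (b * x) * gauss_kernel s x) t
      = exp ((complex_of_real s)\<^sup>2 * (complex_of_real b + \<i> * complex_of_real t)\<^sup>2 / 2)"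
proof -
  define c where "c = exp (b\<^sup>2 * s\<^sup>2 / 2)"
  have eq: "exp (b * x) * gauss_kernel s x = c * gauss_kernel s (x + - (b * s\<^sup>2))" for x
  proof -
    have "b * x + - x\<^sup>2 / (2 * s\<^sup>2) = b\<^sup>2 * s\<^sup>2 / 2 + - (x - b * s\<^sup>2)\<^sup>2 / (2 * s\<^sup>2)"
      using assms by (simp add: power2_eq_square field_simps)
    then have "exp (b * x) * exp (- x\<^sup>2 / (2 * s\<^sup>2)) = c * exp (- (x - b * s\<^sup>2)\<^sup>2 / (2 * s\<^sup>2))"
      unfolding c_def exp_add[symmetric] by simp
    then show ?thesis
      by (simp add: gauss_kernel_def std_normal_density_def power_divide mult_ac)
  qed
  show "integrable lborel (\<lambda>x. exp (b * x) * gauss_kernel s x)"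
    unfolding eq using integrable_gauss_kernel_shift[OF assms] by (rule integrable_mult_right)
  have "fourier (\<lambda>x. exp (b * x) * gauss_kernel s x) t
      = (LINT x|lborel. (c * gauss_kernel s (x + - (b * s\<^sup>2))) *\<^sub>R iexp (t * x))"
    unfolding fourier_def eq ..
  also have "\<dots> = (LINT x|lborel. (c * gauss_kernel s x) *\<^sub>R iexp (t * (b * s\<^sup>2 + x)))"
    using lborel_integral_real_affine[of 1 "\<lambda>x. (c * gauss_kernel s (x + - (b * s\<^sup>2))) *\<^sub>R iexp (t * x)" "b * s\<^sup>2"]
    by simp
  also have "\<dots> = (LINT x|lborel. (complex_of_real c * iexp (t * (b * s\<^sup>2))) * (gauss_kernel s x *\<^sub>R iexp (t * x)))"
    by (simp add: distrib_left exp_add scaleR_conv_of_real mult_ac)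
  also have "\<dots> = complex_of_real c * iexp (t * (b * s\<^sup>2)) * fourier (gauss_kernel s) t"
    unfolding fourier_def by (rule integral_mult_right_zero)
  also have "\<dots> = exp (complex_of_real (b\<^sup>2 * s\<^sup>2 / 2) + \<i> * complex_of_real (t * (b * s\<^sup>2)) + complex_of_real (- (s * t)\<^sup>2 / 2))"
    unfolding fourier_gauss_kernel[OF assms] c_def exp_add exp_of_real ..
  also have "complex_of_real (b\<^sup>2 * s\<^sup>2 / 2) + \<i> * complex_of_real (t * (b * s\<^sup>2)) + complex_of_real (- (s * t)\<^sup>2 / 2)
      = (complex_of_real s)\<^sup>2 * (complex_of_real b + \<i> * complex_of_real t)\<^sup>2 / 2"
    by (simp add: complex_eq_iff power2_eq_square algebra_simps)
  finally show "fourier (\<lambda>x. exp (b * x) * gauss_kernel s x) t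
      = exp ((complex_of_real s)\<^sup>2 * (complex_of_real b + \<i> * complex_of_real t)\<^sup>2 / 2)" .
qed

text \<open>The common core of \<open>T_op\<close> and \<open>h_corr\<close>: tilting
  \<open>T_op\<close> cancels its factors \<open>exp (- b * y)\<close>, so that both lead to this
  sum, for different \<open>g\<close>.\<close>

definition corr ::
    "(real \<Rightarrow> real) \<Rightarrow> real \<Rightarrow> real \<Rightarrow> nat \<Rightarrow> real \<Rightarrow> real \<Rightarrow> (real \<Rightarrow> real) \<Rightarrow> real \<Rightarrow> complex" where
  "corr \<tau> h \<delta> m b \<sigma> g x = (\<Sum>k\<in>{1..<m}. ((- \<sigma>\<^sup>2 / 2) ^ k / fact k) *\<^sub>R
     (\<Sum>j\<le>2 * k. (real (2 * k choose j) * (- b) ^ (2 * k - j)) *\<^sub>R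
        conv g (nderiv j (H_scaled \<tau> h \<delta>)) x))"

lemma h_corr_eq_corr:
  "h_corr \<tau> h \<delta> m b \<sigma> f = (\<lambda>x. (1 / - (1 - exp (- \<sigma>\<^sup>2 / 8))) *\<^sub>R corr \<tau> h \<delta> m b \<sigma> (tilted_density f b) x)"
  by (simp add: fun_eq_iff h_corr_def corr_def Let_def)

lemma exp_T_op_eq_corr:
  "exp (b * x) *\<^sub>R T_op \<tau> h \<delta> m b \<sigma> f x
    = complex_of_real (exp (b * x) * f x) + corr \<tau> h \<delta> m b \<sigma> (\<lambda>u. exp (b * u) * f u) x"
proof -
  have *: "exp (b * x) *\<^sub>R conv f (\<lambda>y. exp (- b * y) *\<^sub>R D y) x = conv (\<lambda>u. exp (b * u) * f u) D x" for D
    unfolding exp_conv_tilt by (simp flip: exp_add)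
  have "exp (b * x) *\<^sub>R (\<Sum>k\<in>{1..<m}. ((- \<sigma>\<^sup>2 / 2) ^ k / fact k) *\<^sub>R
        (\<Sum>j\<le>2 * k. (real (2 * k choose j) * (- b) ^ (2 * k - j)) *\<^sub>R
           conv f (\<lambda>y. exp (- b * y) *\<^sub>R nderiv j (H_scaled \<tau> h \<delta>) y) x))
     = corr \<tau> h \<delta> m b \<sigma> (\<lambda>u. exp (b * u) * f u) x"
    unfolding corr_def scaleR_sum_right *[symmetric] by (simp only: scaleR_scaleR mult_ac)
  then show ?thesis
    unfolding T_op_def scaleR_add_right by (simp add: scaleR_conv_of_real)
qed

lemma
  assumes \<tau>: "bourgain_cutoff \<tau>" "h > 0" "\<delta> > 0" and g: "integrable lborel g"
  shows integrable_corr: "integrable lborel (corr \<tau> h \<delta> m b \<sigma> g)"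
    and ft_corr: "ft (corr \<tau> h \<delta> m b \<sigma> g) t = fourier g t *
      (\<Sum>k\<in>{1..<m}. (- ((complex_of_real \<sigma>)\<^sup>2 * (complex_of_real b + \<i> * complex_of_real t)\<^sup>2 / 2)) ^ k / fact k) *
      ft (H_scaled \<tau> h \<delta>) t"
proof -
  let ?D = "\<lambda>j. nderiv j (H_scaled \<tau> h \<delta>)"
  have int: "integrable lborel (conv g (?D j))" for j
    by (intro integrable_conv g integrable_nderiv_H_scaled \<tau>)
  show "integrable lborel (corr \<tau> h \<delta> m b \<sigma> g)"
    unfolding corr_def[abs_def]
    by (intro Bochner_Integration.integrable_sum integrable_scaleR_right int)
  have "ft (corr \<tau> h \<delta> m b \<sigma> g) t = (\<Sum>k\<in>{1..<m}. ((- \<sigma>\<^sup>2 / 2) ^ k / fact k) *\<^sub>R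
     (\<Sum>j\<le>2 * k. (real (2 * k choose j) * (- b) ^ (2 * k - j)) *\<^sub>R ft (conv g (?D j)) t))"
    unfolding corr_def[abs_def]
    by (subst ft_sum, simp, intro Bochner_Integration.integrable_sum integrable_scaleR_right int,
        intro sum.cong refl, subst ft_scaleR, subst ft_sum, simp, intro integrable_scaleR_right int,
        simp only: ft_scaleR)
  also have "\<dots> = (\<Sum>k\<in>{1..<m}. fourier g t *
      ((- ((complex_of_real \<sigma>)\<^sup>2 * (complex_of_real b + \<i> * complex_of_real t)\<^sup>2 / 2)) ^ k / fact k) *
      ft (H_scaled \<tau> h \<delta>) t)"
  proof (intro sum.cong refl)
    fix k
    have "(\<Sum>j\<le>2 * k. (real (2 * k choose j) * (- b) ^ (2 * k - j)) *\<^sub>R ft (conv g (?D j)) t)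
      = fourier g t * (\<Sum>j\<le>2 * k. of_nat (2 * k choose j) * (- \<i> * complex_of_real t) ^ j * (- complex_of_real b) ^ (2 * k - j)) * ft (H_scaled \<tau> h \<delta>) t"
      unfolding ft_conv[OF g integrable_nderiv_H_scaled[OF \<tau>]] ft_nderiv_H_scaled[OF \<tau>]
        sum_distrib_left sum_distrib_right
      by (intro sum.cong refl) (simp add: scaleR_conv_of_real mult_ac)
    also have "(\<Sum>j\<le>2 * k. of_nat (2 * k choose j) * (- \<i> * complex_of_real t) ^ j * (- complex_of_real b) ^ (2 * k - j))
      = (- \<i> * complex_of_real t + - complex_of_real b) ^ (2 * k)"
      by (rule binomial_ring[symmetric])
    \<comment> \<open>The exponent is even, so the common sign of the two summands
      disappears.\<close>
    also have "\<dots> = ((complex_of_real b + \<i> * complex_of_real t)\<^sup>2) ^ k"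
      unfolding power_mult by (simp add: power2_eq_square algebra_simps)
    finally have *: "(\<Sum>j\<le>2 * k. (real (2 * k choose j) * (- b) ^ (2 * k - j)) *\<^sub>R ft (conv g (?D j)) t)
      = fourier g t * ((complex_of_real b + \<i> * complex_of_real t)\<^sup>2) ^ k * ft (H_scaled \<tau> h \<delta>) t" .
    have "(- ((complex_of_real \<sigma>)\<^sup>2 * (complex_of_real b + \<i> * complex_of_real t)\<^sup>2 / 2)) ^ k
      = (complex_of_real (- \<sigma>\<^sup>2 / 2) * (complex_of_real b + \<i> * complex_of_real t)\<^sup>2) ^ k"
      by simp
    also have "\<dots> = complex_of_real ((- \<sigma>\<^sup>2 / 2) ^ k) * ((complex_of_real b + \<i> * complex_of_real t)\<^sup>2) ^ k"
      unfolding power_mult_distrib of_real_power ..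
    finally show "((- \<sigma>\<^sup>2 / 2) ^ k / fact k) *\<^sub>R (\<Sum>j\<le>2 * k. (real (2 * k choose j) * (- b) ^ (2 * k - j)) *\<^sub>R ft (conv g (?D j)) t)
      = fourier g t * ((- ((complex_of_real \<sigma>)\<^sup>2 * (complex_of_real b + \<i> * complex_of_real t)\<^sup>2 / 2)) ^ k / fact k) *
      ft (H_scaled \<tau> h \<delta>) t"
      unfolding * by (simp add: scaleR_conv_of_real mult_ac)
  qed
  finally show "ft (corr \<tau> h \<delta> m b \<sigma> g) t = fourier g t *
      (\<Sum>k\<in>{1..<m}. (- ((complex_of_real \<sigma>)\<^sup>2 * (complex_of_real b + \<i> * complex_of_real t)\<^sup>2 / 2)) ^ k / fact k) *
      ft (H_scaled \<tau> h \<delta>) t"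
    by (simp add: sum_distrib_left sum_distrib_right)
qed

section \<open>The approximation bounds\<close>

text \<open>The multiplier bounds produce powers of \<open>1 + \<bar>t\<bar>\<close>, the Sobolev
  condition controls powers of \<open>\<bar>t\<bar>\<close>. On the unit interval the transform is
  bounded by the L1 norm; outside, \<open>1 + \<bar>t\<bar> \<le> 2 * \<bar>t\<bar>\<close>.\<close>

lemma integrable_weight_extend:
  assumes g: "integrable lborel g" and \<alpha>: "\<alpha> > 0"
    and w: "integrable lborel (\<lambda>t. \<bar>t\<bar> powr (2 * \<alpha>) * (norm (fourier g t))\<^sup>2)"
  shows "integrable lborel (\<lambda>t. (1 + \<bar>t\<bar>) powr (2 * \<alpha>) * (norm (fourier g t))\<^sup>2)"
proof -
  have gc: "integrable lborel (\<lambda>x. complex_of_real (g x))" using g by simp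
  then have [measurable]: "fourier g \<in> borel_measurable borel"
    using borel_measurable_ft[of "\<lambda>x. complex_of_real (g x)"] by (simp add: fourier_eq_ft[abs_def])
  define M where "M = (LINT x|lborel. \<bar>g x\<bar>)"
  have M: "norm (fourier g t) \<le> M" for t
    using norm_ft_le[of "\<lambda>x. complex_of_real (g x)" t] by (simp add: fourier_eq_ft M_def)
  have "integrable lborel (\<lambda>t. 2 powr (2 * \<alpha>) * (M\<^sup>2 * indicator {-1..1} t + \<bar>t\<bar> powr (2 * \<alpha>) * (norm (fourier g t))\<^sup>2))"
    using w by (intro integrable_mult_right Bochner_Integration.integrable_add) auto
  then show ?thesis
  proof (rule Bochner_Integration.integrable_bound)
    show "AE t in lborel. norm ((1 + \<bar>t\<bar>) powr (2 * \<alpha>) * (norm (fourier g t))\<^sup>2)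
        \<le> norm (2 powr (2 * \<alpha>) * (M\<^sup>2 * indicator {-1..1} t + \<bar>t\<bar> powr (2 * \<alpha>) * (norm (fourier g t))\<^sup>2))"
    proof (rule AE_I2)
      fix t :: real
      let ?N = "(norm (fourier g t))\<^sup>2"
      have "(1 + \<bar>t\<bar>) powr (2 * \<alpha>) * ?N
        \<le> 2 powr (2 * \<alpha>) * (M\<^sup>2 * indicator {-1..1} t + \<bar>t\<bar> powr (2 * \<alpha>) * ?N)"
      proof (cases "\<bar>t\<bar> \<le> 1")
        case True
        have "(1 + \<bar>t\<bar>) powr (2 * \<alpha>) * ?N \<le> 2 powr (2 * \<alpha>) * M\<^sup>2"
          using True \<alpha> M by (intro mult_mono powr_mono2 power_mono) auto
        also have "\<dots> \<le> 2 powr (2 * \<alpha>) * (M\<^sup>2 * indicator {-1..1} t + \<bar>t\<bar> powr (2 * \<alpha>) * ?N)"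
        proof (rule mult_left_mono)
          have "indicator {-1..1} t = (1 :: real)" using True by (auto simp: indicator_def)
          then show "M\<^sup>2 \<le> M\<^sup>2 * indicator {-1..1} t + \<bar>t\<bar> powr (2 * \<alpha>) * ?N" by simp
        qed simp
        finally show ?thesis .
      next
        case False
        then have "(1 + \<bar>t\<bar>) powr (2 * \<alpha>) * ?N \<le> (2 * \<bar>t\<bar>) powr (2 * \<alpha>) * ?N"
          using \<alpha> by (intro mult_right_mono powr_mono2) auto
        also have "\<dots> = 2 powr (2 * \<alpha>) * (\<bar>t\<bar> powr (2 * \<alpha>) * ?N)"
          by (simp add: powr_mult)
        also have "\<dots> \<le> 2 powr (2 * \<alpha>) * (M\<^sup>2 * indicator {-1..1} t + \<bar>t\<bar> powr (2 * \<alpha>) * ?N)"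
          by (intro mult_left_mono) auto
        finally show ?thesis .
      qed
      then show "norm ((1 + \<bar>t\<bar>) powr (2 * \<alpha>) * ?N)
        \<le> norm (2 powr (2 * \<alpha>) * (M\<^sup>2 * indicator {-1..1} t + \<bar>t\<bar> powr (2 * \<alpha>) * ?N))"
        by simp
    qed
  qed measurable
qed

text \<open>The estimate is for one \<open>b\<close> and for every \<open>\<sigma>\<close> between 0
  and 1; apart from the displayed power, the constant depends only on \<open>m\<close>,
  \<open>\<alpha>\<close> and the tilted function.\<close>

lemma L2norm_sq_smoothed_difference_le:
  fixes f :: "real \<Rightarrow> real"
  defines "g b \<equiv> \<lambda>x. exp (b * x) * f x"
  assumes \<tau>: "bourgain_cutoff \<tau>" and \<alpha>: "\<alpha> > 0" and m: "m \<ge> 2" "\<alpha> + 2 \<le> 2 * real m"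
    and \<sigma>: "0 < \<sigma>" "\<sigma> < 1" and ch: "0 < c\<^sub>h" "c\<^sub>h \<le> 1 / (4 * real m)" and cd: "0 < c\<^sub>\<delta>" "c\<^sub>\<delta> < 1"
    and b: "b\<^sup>2 = 1 / 4" and g: "integrable lborel (g b)"
    and w: "integrable lborel (\<lambda>t. \<bar>t\<bar> powr (2 * \<alpha>) * (norm (fourier (g b) t))\<^sup>2)"
  shows "L2norm_sq (\<lambda>x. exp (b * x) *\<^sub>R conv laplace_density
      (\<lambda>y. conv (gauss_kernel \<sigma>) (T_op \<tau> (bandwidth_h c\<^sub>h \<sigma>) (bandwidth_delta c\<^sub>\<delta> \<sigma>) m b \<sigma> f) y
        - complex_of_real (f y)) x)
    \<le> ennreal ((216 * 2 ^ (2 * m))\<^sup>2 * (LINT t|lborel. (1 + \<bar>t\<bar>) powr (2 * \<alpha>) * (norm (fourier (g b) t))\<^sup>2) / (2 * pi)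
        * \<sigma> powr (2 * (\<alpha> + 2)))"
proof -
  define h where "h = bandwidth_h c\<^sub>h \<sigma>"
  define \<delta> where "\<delta> = bandwidth_delta c\<^sub>\<delta> \<sigma>"
  have h: "h > 0" and h_le: "exp (- 1 / (16 * h\<^sup>2)) \<le> \<sigma> ^ (2 * m)"
    unfolding h_def using exp_bandwidth_h_le[OF \<sigma> ch m(1)] by auto
  have \<delta>: "\<delta> > 0" unfolding \<delta>_def bandwidth_delta_def using cd \<sigma> by simp
  define E where "E t = (LINT u|lborel. \<tau> u * gauss_kernel h (u + \<delta> * t))" for t
  define z where "z t = (complex_of_real \<sigma>)\<^sup>2 * (complex_of_real b + \<i> * complex_of_real t)\<^sup>2 / 2" for t
  define A where "A t = exp (z t) * (1 + (\<Sum>k\<in>{1..<m}. (- z t) ^ k / fact k) * complex_of_real (E t)) - 1" for t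
  define L where "L x = exp (b * x) * laplace_density x" for x
  define G where "G y = complex_of_real (g b y) + corr \<tau> h \<delta> m b \<sigma> (g b) y" for y
  define P where "P y = conv (\<lambda>u. exp (b * u) * gauss_kernel \<sigma> u) G y - complex_of_real (g b y)" for y
  define F where "F = conv L P"

  have F_eq: "(\<lambda>x. exp (b * x) *\<^sub>R conv laplace_density
      (\<lambda>y. conv (gauss_kernel \<sigma>) (T_op \<tau> h \<delta> m b \<sigma> f) y - complex_of_real (f y)) x) = F"
  proof
    fix x
    have "exp (b * y) *\<^sub>R (conv (gauss_kernel \<sigma>) (T_op \<tau> h \<delta> m b \<sigma> f) y - complex_of_real (f y)) = P y" for y
      unfolding scaleR_diff_right exp_conv_tilt exp_T_op_eq_corr P_def G_def[abs_def] g_def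
      by (simp add: scaleR_conv_of_real)
    then show "exp (b * x) *\<^sub>R conv laplace_density
      (\<lambda>y. conv (gauss_kernel \<sigma>) (T_op \<tau> h \<delta> m b \<sigma> f) y - complex_of_real (f y)) x = F x"
      unfolding exp_conv_tilt F_def L_def[abs_def] by simp
  qed

  have gc: "integrable lborel (\<lambda>y. complex_of_real (g b y))" using g by simp
  have corr_int: "integrable lborel (corr \<tau> h \<delta> m b \<sigma> (g b))"
    by (rule integrable_corr[OF \<tau> h \<delta> g])
  have G_int: "integrable lborel G"
    unfolding G_def[abs_def] by (intro Bochner_Integration.integrable_add gc corr_int)
  note tg = integrable_tilted_gauss[OF \<sigma>(1), of b]
  have P_int: "integrable lborel P"
    unfolding P_def[abs_def] by (intro Bochner_Integration.integrable_diff gc integrable_conv tg G_int)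
  have "ft G t = fourier (g b) t * (1 + (\<Sum>k\<in>{1..<m}. (- z t) ^ k / fact k) * complex_of_real (E t))" for t
    unfolding G_def[abs_def] ft_add[OF gc corr_int] ft_corr[OF \<tau> h \<delta> g] ft_H_scaled[OF \<tau> h \<delta>]
    by (simp add: fourier_eq_ft z_def E_def algebra_simps)
  then have ft_P: "ft P t = fourier (g b) t * A t" for t
    unfolding P_def[abs_def] ft_diff[OF integrable_conv[OF tg G_int] gc] ft_conv[OF tg G_int]
      fourier_tilted_gauss[OF \<sigma>(1)] z_def[symmetric] A_def
    by (simp add: fourier_eq_ft algebra_simps)

  have b_half: "\<bar>b\<bar> \<le> 1 / 2"
    using b abs_le_square_iff[of b "1 / 2"] by (simp add: power_divide)
  note L_int = norm_fourier_tilted_laplace_le(1)[OF b_half, folded L_def]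
  have L_cont: "continuous_on UNIV L"
    unfolding L_def[abs_def] laplace_density_def by (intro continuous_intros) simp
  have L_le: "\<bar>L x\<bar> \<le> 1 / 2" for x
  proof -
    have "b * x \<le> \<bar>b\<bar> * \<bar>x\<bar>" by (metis abs_ge_self abs_mult)
    also have "\<dots> \<le> 1 * \<bar>x\<bar>" using b_half by (intro mult_right_mono) auto
    finally have "exp (b * x + - \<bar>x\<bar>) \<le> 1" by simp
    then show ?thesis unfolding L_def laplace_density_def exp_add by simp
  qed
  have F_int: "integrable lborel F"
    unfolding F_def by (rule integrable_conv[OF L_int P_int])
  have ft_F: "ft F t = fourier L t * (fourier (g b) t * A t)" for t
    unfolding F_def ft_conv[OF L_int P_int] ft_P ..

  have A_le: "norm (A t) \<le> 27 * 2 ^ (2 * m) * (\<sigma> * (1 + \<bar>t\<bar>)) powr (\<alpha> + 2)" for t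
    unfolding A_def z_def
  proof (rule multiplier_bound[OF \<sigma> b])
    show "0 \<le> E t" "E t \<le> 1"
      unfolding E_def by (rule smoothed_cutoff_nonneg[OF \<tau> h] smoothed_cutoff_le_1[OF \<tau> h])+
    show "1 - E t \<le> sqrt 2 * \<sigma> ^ (2 * m)" if t: "\<sigma> * \<bar>t\<bar> \<le> 1 / 2"
    proof -
      \<comment> \<open>\<open>c\<^sub>\<delta> < 1\<close> carries the frequency threshold over to
        the shift of the cutoff.\<close>
      have "\<bar>\<delta> * t\<bar> = c\<^sub>\<delta> * (\<sigma> * \<bar>t\<bar>)"
        using cd \<sigma> by (simp add: \<delta>_def bandwidth_delta_def abs_mult)
      also have "\<dots> \<le> 1 * (\<sigma> * \<bar>t\<bar>)" using cd \<sigma> by (intro mult_right_mono) auto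
      finally have "\<bar>\<delta> * t\<bar> \<le> 1 / 2" using t by simp
      then have "1 - E t \<le> sqrt 2 * exp (- 1 / (16 * h\<^sup>2))"
        unfolding E_def by (rule smoothed_cutoff_ge[OF \<tau> h])
      also have "\<dots> \<le> sqrt 2 * \<sigma> ^ (2 * m)" using h_le by (intro mult_left_mono) auto
      finally show ?thesis .
    qed
  qed (use m \<alpha> in auto)
  have ft_F_le: "(norm (ft F t))\<^sup>2 \<le> (216 * 2 ^ (2 * m))\<^sup>2 * \<sigma> powr (2 * (\<alpha> + 2)) *
      ((1 + \<bar>t\<bar>) powr (2 * \<alpha>) * (norm (fourier (g b) t))\<^sup>2)" for t
  proof -
    have p: "1 + \<bar>t\<bar> > 0" by simp
    have "norm (ft F t) = norm (fourier L t) * (norm (fourier (g b) t) * norm (A t))"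
      unfolding ft_F by (simp add: norm_mult)
    also have "\<dots> \<le> 8 / (1 + \<bar>t\<bar>)\<^sup>2 * (norm (fourier (g b) t) * (27 * 2 ^ (2 * m) * (\<sigma> * (1 + \<bar>t\<bar>)) powr (\<alpha> + 2)))"
      unfolding L_def[abs_def]
      by (intro mult_mono norm_fourier_tilted_laplace_le b_half A_le) (auto intro!: mult_nonneg_nonneg)
    also have "(\<sigma> * (1 + \<bar>t\<bar>)) powr (\<alpha> + 2) = \<sigma> powr (\<alpha> + 2) * ((1 + \<bar>t\<bar>) powr \<alpha> * (1 + \<bar>t\<bar>)\<^sup>2)"
      using p \<sigma> by (simp add: powr_mult powr_add powr_realpow)
    \<comment> \<open>\<open>216 = 8 * 27\<close>, from the Laplace and the multiplier
      bound.\<close>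
    also have "8 / (1 + \<bar>t\<bar>)\<^sup>2 * (norm (fourier (g b) t) * (27 * 2 ^ (2 * m) * (\<sigma> powr (\<alpha> + 2) * ((1 + \<bar>t\<bar>) powr \<alpha> * (1 + \<bar>t\<bar>)\<^sup>2))))
       = 216 * 2 ^ (2 * m) * \<sigma> powr (\<alpha> + 2) * ((1 + \<bar>t\<bar>) powr \<alpha> * norm (fourier (g b) t))"
      using p by (simp add: field_simps)
    finally have "(norm (ft F t))\<^sup>2 \<le> (216 * 2 ^ (2 * m) * \<sigma> powr (\<alpha> + 2) * ((1 + \<bar>t\<bar>) powr \<alpha> * norm (fourier (g b) t)))\<^sup>2"
      by (rule power_mono) simp
    also have "\<dots> = (216 * 2 ^ (2 * m))\<^sup>2 * (\<sigma> powr (\<alpha> + 2))\<^sup>2 * (((1 + \<bar>t\<bar>) powr \<alpha>)\<^sup>2 * (norm (fourier (g b) t))\<^sup>2)"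
      by (simp only: power_mult_distrib)
    also have "(\<sigma> powr (\<alpha> + 2))\<^sup>2 = \<sigma> powr (2 * (\<alpha> + 2))"
      by (simp add: power2_eq_square mult.commute flip: powr_add)
    also have "((1 + \<bar>t\<bar>) powr \<alpha>)\<^sup>2 = (1 + \<bar>t\<bar>) powr (2 * \<alpha>)"
      by (simp add: power2_eq_square mult.commute flip: powr_add)
    finally show ?thesis .
  qed
  have W: "integrable lborel (\<lambda>t. (216 * 2 ^ (2 * m))\<^sup>2 * \<sigma> powr (2 * (\<alpha> + 2)) *
      ((1 + \<bar>t\<bar>) powr (2 * \<alpha>) * (norm (fourier (g b) t))\<^sup>2))"
    by (intro integrable_mult_right integrable_weight_extend g \<alpha> w)
  have [measurable]: "F \<in> borel_measurable borel" using F_int by auto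
  have sq: "integrable lborel (\<lambda>t. (norm (ft F t))\<^sup>2)"
  proof (rule Bochner_Integration.integrable_bound[OF W])
    show "AE t in lborel. norm ((norm (ft F t))\<^sup>2) \<le> norm ((216 * 2 ^ (2 * m))\<^sup>2 * \<sigma> powr (2 * (\<alpha> + 2)) *
      ((1 + \<bar>t\<bar>) powr (2 * \<alpha>) * (norm (fourier (g b) t))\<^sup>2))"
    proof (rule AE_I2)
      fix t
      show "norm ((norm (ft F t))\<^sup>2) \<le> norm ((216 * 2 ^ (2 * m))\<^sup>2 * \<sigma> powr (2 * (\<alpha> + 2)) *
        ((1 + \<bar>t\<bar>) powr (2 * \<alpha>) * (norm (fourier (g b) t))\<^sup>2))"
        using order_trans[OF ft_F_le[of t] abs_ge_self] by simp
    qed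
  qed measurable
  have "L2norm_sq F \<le> ennreal ((LINT t|lborel. (norm (ft F t))\<^sup>2) / (2 * pi))"
    using continuous_on_conv[OF L_cont L_le P_int] norm_conv_le[OF L_cont L_le P_int]
    unfolding F_def[symmetric] by (intro L2norm_sq_le_ft F_int sq)
  also have "\<dots> \<le> ennreal ((LINT t|lborel. (216 * 2 ^ (2 * m))\<^sup>2 * \<sigma> powr (2 * (\<alpha> + 2)) *
      ((1 + \<bar>t\<bar>) powr (2 * \<alpha>) * (norm (fourier (g b) t))\<^sup>2)) / (2 * pi))"
    by (intro ennreal_leI divide_right_mono integral_mono sq W ft_F_le) simp
  finally show ?thesis
    unfolding h_def[symmetric] \<delta>_def[symmetric] F_eq integral_mult_right_zero by (simp add: mult_ac)
qed

text \<open>At \<open>t = 0\<close> the exponent \<open>z\<close> is the real number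
  \<open>v = \<sigma>\<^sup>2 / 8\<close>, and the integral is \<open>S * E / \<gamma>\<close>. Here
  \<open>\<gamma> = exp (- v) - 1\<close> is the full series of which \<open>S\<close> is a section,
  so \<open>S - \<gamma>\<close> is of order \<open>v ^ m\<close>; dividing by
  \<open>\<gamma>\<close>, which is of order \<open>v\<close>, loses one power of \<open>v\<close>
  and leaves \<open>m - 1\<close>.\<close>

lemma h_corr_integral:
  fixes f :: "real \<Rightarrow> real"
  assumes \<tau>: "bourgain_cutoff \<tau>" and m: "m \<ge> 2"
    and \<sigma>: "0 < \<sigma>" "\<sigma> < 1" and ch: "0 < c\<^sub>h" "c\<^sub>h \<le> 1 / (4 * real m)" and cd: "0 < c\<^sub>\<delta>"
    and b: "b\<^sup>2 = 1 / 4" and f: "integrable lborel (tilted_density f b)" "(LINT x|lborel. tilted_density f b x) = 1"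
  defines "H \<equiv> h_corr \<tau> (bandwidth_h c\<^sub>h \<sigma>) (bandwidth_delta c\<^sub>\<delta> \<sigma>) m b \<sigma> f"
  shows "integrable lborel H" and "norm ((LINT x|lborel. H x) - 1) \<le> 8 * \<sigma> ^ (2 * (m - 1))"
proof -
  define h where "h = bandwidth_h c\<^sub>h \<sigma>"
  define \<delta> where "\<delta> = bandwidth_delta c\<^sub>\<delta> \<sigma>"
  have h: "h > 0" and h_le: "exp (- 1 / (16 * h\<^sup>2)) \<le> \<sigma> ^ (2 * m)"
    unfolding h_def using exp_bandwidth_h_le[OF \<sigma> ch m] by auto
  have \<delta>: "\<delta> > 0" unfolding \<delta>_def bandwidth_delta_def using cd \<sigma> by simp
  define E where "E = (LINT u|lborel. \<tau> u * gauss_kernel h (u + \<delta> * 0))"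
  define v where "v = \<sigma>\<^sup>2 / 8"
  define \<gamma> where "\<gamma> = - (1 - exp (- v))"
  define S where "S = (\<Sum>k\<in>{1..<m}. (- complex_of_real v) ^ k / fact k)"
  have H: "H = (\<lambda>x. (1 / \<gamma>) *\<^sub>R corr \<tau> h \<delta> m b \<sigma> (tilted_density f b) x)"
    unfolding H_def h_corr_eq_corr \<gamma>_def v_def h_def \<delta>_def by simp
  show "integrable lborel H"
    unfolding H by (intro integrable_scaleR_right integrable_corr \<tau> h \<delta> f)
  have v: "0 < v" "v \<le> 1" "v \<le> \<sigma>\<^sup>2"
    unfolding v_def using \<sigma> power_le_one[of \<sigma> 2] by auto
  have bb: "(complex_of_real b)\<^sup>2 = 1 / 4"
    using b by (metis of_real_1 of_real_divide of_real_numeral of_real_power)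
  have z: "(complex_of_real \<sigma>)\<^sup>2 * (complex_of_real b + \<i> * complex_of_real 0)\<^sup>2 / 2 = complex_of_real v"
    by (simp add: v_def bb)
  have "fourier (tilted_density f b) 0 = complex_of_real (LINT x|lborel. tilted_density f b x)"
    unfolding fourier_def integral_complex_of_real[symmetric] by (simp add: scaleR_conv_of_real)
  then have "ft (corr \<tau> h \<delta> m b \<sigma> (tilted_density f b)) 0 = S * complex_of_real E"
    unfolding ft_corr[OF \<tau> h \<delta> f(1)] ft_H_scaled[OF \<tau> h \<delta>] z S_def E_def f(2) by simp
  then have "(LINT x|lborel. H x) = (1 / \<gamma>) *\<^sub>R (S * complex_of_real E)"
    using ft_scaleR[of "1 / \<gamma>" "corr \<tau> h \<delta> m b \<sigma> (tilted_density f b)" 0] unfolding H by (simp add: ft_def)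
  \<comment> \<open>This gives the lower bound \<open>v / 2\<close> for
    \<open>\<bar>\<gamma>\<bar>\<close>, as \<open>v \<le> 1\<close>.\<close>
  moreover have "exp (- v) \<le> 1 / (1 + v)"
    using exp_ge_add_one_self[of v] v by (simp add: exp_minus inverse_eq_divide divide_left_mono)
  then have "v / (1 + v) \<le> 1 - exp (- v)" using v by (simp add: field_simps)
  then have "v / 2 \<le> 1 - exp (- v)"
  proof (rule order_trans[rotated])
    show "v / 2 \<le> v / (1 + v)" using v by (intro divide_left_mono) auto
  qed
  ultimately have \<gamma>: "\<gamma> < 0" "v / 2 \<le> \<bar>\<gamma>\<bar>" and
    int: "(LINT x|lborel. H x) = S * complex_of_real E / complex_of_real \<gamma>"
    unfolding \<gamma>_def using v by (auto simp: scaleR_conv_of_real)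
  have "0 \<le> E" "E \<le> 1" "1 - E \<le> sqrt 2 * exp (- 1 / (16 * h\<^sup>2))"
    unfolding E_def
    by (rule smoothed_cutoff_nonneg[OF \<tau> h] smoothed_cutoff_le_1[OF \<tau> h] smoothed_cutoff_ge[OF \<tau> h]; simp)+
  moreover have "sqrt 2 * exp (- 1 / (16 * h\<^sup>2)) \<le> 2 * \<sigma> ^ (2 * (m - 1))"
  proof (intro mult_mono)
    show "sqrt 2 \<le> 2" by (simp add: real_le_lsqrt)
    have "\<sigma> ^ (2 * m) \<le> \<sigma> ^ (2 * (m - 1))" using \<sigma> by (intro power_decreasing) auto
    then show "exp (- 1 / (16 * h\<^sup>2)) \<le> \<sigma> ^ (2 * (m - 1))" using h_le by linarith
  qed auto
  ultimately have E: "0 \<le> E" "E \<le> 1" "\<bar>E - 1\<bar> \<le> 2 * \<sigma> ^ (2 * (m - 1))" by auto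
  have "norm (S - complex_of_real \<gamma>) = norm (exp (- complex_of_real v) - (1 + S))"
    unfolding \<gamma>_def by (subst norm_minus_commute) (simp add: exp_of_real[symmetric] algebra_simps)
  also have "\<dots> \<le> exp v * v ^ m"
    using exp_remainder_le[of m "- complex_of_real v"] m v unfolding S_def by simp
  also have "\<dots> \<le> 3 * v ^ m" using v by (intro mult_right_mono exp_le_3) auto
  also have "v ^ m = v * v ^ (m - 1)" using m by (cases m) auto
  finally have Sg: "norm (S - complex_of_real \<gamma>) \<le> 3 * (v * v ^ (m - 1))" .
  have "v ^ (m - 1) \<le> (\<sigma>\<^sup>2) ^ (m - 1)" using v by (intro power_mono) auto
  then have vs: "v ^ (m - 1) \<le> \<sigma> ^ (2 * (m - 1))" by (simp only: power_mult)
  have "3 * (v * v ^ (m - 1)) \<le> 3 * ((2 * \<bar>\<gamma>\<bar>) * \<sigma> ^ (2 * (m - 1)))"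
    using \<gamma> v vs by (intro mult_left_mono mult_mono) auto
  with Sg have "norm (S - complex_of_real \<gamma>) \<le> 6 * \<sigma> ^ (2 * (m - 1)) * \<bar>\<gamma>\<bar>"
    by (simp add: mult_ac)
  then have Sg': "norm (S - complex_of_real \<gamma>) / \<bar>\<gamma>\<bar> \<le> 6 * \<sigma> ^ (2 * (m - 1))"
    using \<gamma> by (subst pos_divide_le_eq) auto
  have "(LINT x|lborel. H x) - 1 = (S - complex_of_real \<gamma>) / complex_of_real \<gamma> * complex_of_real E + complex_of_real (E - 1)"
    unfolding int using \<gamma> by (simp add: field_simps)
  then have "norm ((LINT x|lborel. H x) - 1)
      \<le> norm ((S - complex_of_real \<gamma>) / complex_of_real \<gamma> * complex_of_real E) + norm (complex_of_real (E - 1))"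
    by (simp only: norm_triangle_ineq)
  also have "\<dots> = norm (S - complex_of_real \<gamma>) / \<bar>\<gamma>\<bar> * E + \<bar>E - 1\<bar>"
    using E unfolding norm_of_real norm_mult norm_divide by simp
  also have "\<dots> \<le> norm (S - complex_of_real \<gamma>) / \<bar>\<gamma>\<bar> * 1 + \<bar>E - 1\<bar>"
    using E by (intro add_right_mono mult_left_mono) auto
  \<comment> \<open>\<open>8 = 6 + 2\<close>: the truncation error relative to
    \<open>\<gamma>\<close>, and the cutoff error.\<close>
  also have "\<dots> \<le> 8 * \<sigma> ^ (2 * (m - 1))" using Sg' E by linarith
  finally show "norm ((LINT x|lborel. H x) - 1) \<le> 8 * \<sigma> ^ (2 * (m - 1))" .
qed

lemma integrable_exp_tilt:
  fixes f :: "real \<Rightarrow> real"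
  assumes [measurable]: "f \<in> borel_measurable borel" and int: "integrable lborel (\<lambda>x. exp (\<bar>x\<bar> / 2) * f x)"
    and b: "\<bar>b\<bar> \<le> 1 / 2"
  shows "integrable lborel (\<lambda>x. exp (b * x) * f x)"
proof (rule Bochner_Integration.integrable_bound[OF int])
  show "AE x in lborel. norm (exp (b * x) * f x) \<le> norm (exp (\<bar>x\<bar> / 2) * f x)"
  proof (rule AE_I2)
    fix x
    have "b * x \<le> \<bar>b\<bar> * \<bar>x\<bar>" by (metis abs_ge_self abs_mult)
    also have "\<dots> \<le> 1 / 2 * \<bar>x\<bar>" using b by (intro mult_right_mono) auto
    finally show "norm (exp (b * x) * f x) \<le> norm (exp (\<bar>x\<bar> / 2) * f x)"
      by (auto simp: abs_mult intro!: mult_right_mono)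
  qed
qed measurable

lemma
  assumes f: "probability_density f" and int: "integrable lborel (\<lambda>x. exp (b * x) * f x)"
  shows integrable_tilted_density: "integrable lborel (tilted_density f b)"
    and integral_tilted_density: "(LINT x|lborel. tilted_density f b x) = 1"
proof -
  have [measurable]: "f \<in> borel_measurable borel" and nonneg: "\<And>x. 0 \<le> f x"
    and one: "(\<integral>\<^sup>+x. ennreal (f x) \<partial>lborel) = 1"
    using f by (auto simp: probability_density_def)
  show "integrable lborel (tilted_density f b)"
    unfolding tilted_density_def[abs_def] using int by (rule integrable_divide)
  \<comment> \<open>Dividing by 0 would make the tilted density the zero function. A zero integral
    would force \<open>f\<close> to vanish almost everywhere, against its total mass 1.\<close>
  have "mgf f b \<noteq> 0"
  proof
    assume "mgf f b = 0"
    then have "AE x in lborel. exp (b * x) * f x = 0"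
      unfolding mgf_def using nonneg by (subst (asm) integral_nonneg_eq_0_iff_AE[OF int]) auto
    then have "AE x in lborel. ennreal (f x) = 0" by eventually_elim simp
    then have "(\<integral>\<^sup>+x. ennreal (f x) \<partial>lborel) = 0" by (subst nn_integral_0_iff_AE) auto
    then show False using one by simp
  qed
  then show "(LINT x|lborel. tilted_density f b x) = 1"
    unfolding tilted_density_def[abs_def] by (simp add: mgf_def)
qed

theorem lemma4p1:
  fixes \<tau> :: "real \<Rightarrow> real" and \<alpha> :: real and m :: nat
  assumes "bourgain_cutoff \<tau>"
    and "\<alpha> > 0"
    and "real m \<ge> max 2 ((\<alpha> + 2) / 2)"
  shows "\<exists>c\<^sub>0::real. 0 < c\<^sub>0 \<and> c\<^sub>0 < 1 \<and>
    (\<forall>c\<^sub>h c\<^sub>\<delta> :: real. 0 < c\<^sub>h \<and> c\<^sub>h \<le> c\<^sub>0 \<and> 0 < c\<^sub>\<delta> \<and> c\<^sub>\<delta> < 1 \<longrightarrow>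
      (\<forall>f\<^sub>0 :: real \<Rightarrow> real.
        probability_density f\<^sub>0 \<and>
        integrable lborel (\<lambda>x. exp (\<bar>x\<bar> / 2) * f\<^sub>0 x) \<and>
        (\<forall>b\<in>{- 1 / 2, 1 / 2}.
           integrable lborel
             (\<lambda>t. \<bar>t\<bar> powr (2 * \<alpha>) * (cmod (fourier (\<lambda>x. exp (b * x) * f\<^sub>0 x) t))\<^sup>2)) \<longrightarrow>
        (\<exists>C>0. \<forall>\<^sub>F \<sigma> in at_right 0.
           (\<Sum>b\<in>{- 1 / 2, 1 / 2}. L2norm_sq (\<lambda>x. exp (b * x) *\<^sub>R
              conv laplace_density
                (\<lambda>y. conv (gauss_kernel \<sigma>)
                       (T_op \<tau> (bandwidth_h c\<^sub>h \<sigma>) (bandwidth_delta c\<^sub>\<delta> \<sigma>) m b \<sigma> f\<^sub>0) y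
                     - complex_of_real (f\<^sub>0 y)) x))
           \<le> ennreal (C * \<sigma> powr (2 * (\<alpha> + 2)))) \<and>
        (\<forall>b\<in>{- 1 / 2, 1 / 2}.
           (\<forall>\<^sub>F \<sigma> in at_right 0. integrable lborel
              (h_corr \<tau> (bandwidth_h c\<^sub>h \<sigma>) (bandwidth_delta c\<^sub>\<delta> \<sigma>) m b \<sigma> f\<^sub>0)) \<and>
           (\<lambda>\<sigma>. (LINT x|lborel.
                   h_corr \<tau> (bandwidth_h c\<^sub>h \<sigma>) (bandwidth_delta c\<^sub>\<delta> \<sigma>) m b \<sigma> f\<^sub>0 x) - 1)
             \<in> O[at_right 0](\<lambda>\<sigma>. of_real (\<sigma> ^ (2 * (m - 1)))))))"
proof -
  have m: "m \<ge> 2" "\<alpha> + 2 \<le> 2 * real m" using assms(3) by auto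
  show ?thesis
  \<comment> \<open>The witness is the largest \<open>c\<^sub>h\<close> that
    \<open>exp_bandwidth_h_le\<close> admits; it depends on \<open>m\<close> alone.\<close>
  proof (rule exI[where x = "1 / (4 * real m)"], intro conjI allI impI)
    show "0 < 1 / (4 * real m)" "1 / (4 * real m) < 1" using m by auto
  next
    fix c\<^sub>h c\<^sub>\<delta> :: real and f\<^sub>0 :: "real \<Rightarrow> real"
    assume "0 < c\<^sub>h \<and> c\<^sub>h \<le> 1 / (4 * real m) \<and> 0 < c\<^sub>\<delta> \<and> c\<^sub>\<delta> < 1"
    then have ch: "0 < c\<^sub>h" "c\<^sub>h \<le> 1 / (4 * real m)" and cd: "0 < c\<^sub>\<delta>" "c\<^sub>\<delta> < 1"
      by auto
    assume asm: "probability_density f\<^sub>0 \<and> integrable lborel (\<lambda>x. exp (\<bar>x\<bar> / 2) * f\<^sub>0 x) \<and>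
        (\<forall>b\<in>{- 1 / 2, 1 / 2}. integrable lborel
           (\<lambda>t. \<bar>t\<bar> powr (2 * \<alpha>) * (cmod (fourier (\<lambda>x. exp (b * x) * f\<^sub>0 x) t))\<^sup>2))"
    note f = asm[THEN conjunct1] and f' = asm[THEN conjunct2, THEN conjunct1] and w = asm[THEN conjunct2, THEN conjunct2]
    define B :: "real set" where "B = {- 1 / 2, 1 / 2}"
    have B: "b\<^sup>2 = 1 / 4" "\<bar>b\<bar> \<le> 1 / 2" if "b \<in> B" for b
    proof -
      have b: "b = - (1 / 2) \<or> b = 1 / 2" using that by (simp add: B_def)
      show "b\<^sup>2 = 1 / 4" using b by (elim disjE ssubst) (simp_all add: power_divide)
      show "\<bar>b\<bar> \<le> 1 / 2" using b by (elim disjE ssubst) simp_all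
    qed
    have g: "integrable lborel (\<lambda>x. exp (b * x) * f\<^sub>0 x)" if "b \<in> B" for b
      using f by (intro integrable_exp_tilt f' B that) (simp add: probability_density_def)
    define K where "K b = (216 * 2 ^ (2 * m))\<^sup>2 *
      (LINT t|lborel. (1 + \<bar>t\<bar>) powr (2 * \<alpha>) * (norm (fourier (\<lambda>x. exp (b * x) * f\<^sub>0 x) t))\<^sup>2) / (2 * pi)" for b :: real
    have K0: "K b \<ge> 0" for b
      unfolding K_def by (intro divide_nonneg_nonneg mult_nonneg_nonneg Bochner_Integration.integral_nonneg) auto
    have L2: "(\<Sum>b\<in>B. L2norm_sq (\<lambda>x. exp (b * x) *\<^sub>R conv laplace_density
                (\<lambda>y. conv (gauss_kernel \<sigma>)
                       (T_op \<tau> (bandwidth_h c\<^sub>h \<sigma>) (bandwidth_delta c\<^sub>\<delta> \<sigma>) m b \<sigma> f\<^sub>0) y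
                     - complex_of_real (f\<^sub>0 y)) x))
        \<le> ennreal ((1 + (\<Sum>b\<in>B. K b)) * \<sigma> powr (2 * (\<alpha> + 2)))" (is "?S \<le> _")
      if \<sigma>: "\<sigma> \<in> {0<..<1}" for \<sigma>
    proof -
      have "?S \<le> (\<Sum>b\<in>B. ennreal (K b * \<sigma> powr (2 * (\<alpha> + 2))))"
        unfolding K_def
        using \<sigma> w[folded B_def] by (intro sum_mono L2norm_sq_smoothed_difference_le assms m ch cd B g) auto
      also have "\<dots> = ennreal (\<Sum>b\<in>B. K b * \<sigma> powr (2 * (\<alpha> + 2)))"
        by (rule sum_ennreal) (simp add: K0)
      also have "\<dots> \<le> ennreal ((1 + (\<Sum>b\<in>B. K b)) * \<sigma> powr (2 * (\<alpha> + 2)))"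
        by (intro ennreal_leI) (simp add: distrib_right flip: sum_distrib_right)
      finally show ?thesis .
    qed
    \<comment> \<open>The added 1 makes the constant positive without a lower bound on the integrals
      in \<open>K\<close>.\<close>
    have pos: "0 < 1 + (\<Sum>b\<in>B. K b)" by (intro add_pos_nonneg sum_nonneg K0) simp
    show "\<exists>C>0. \<forall>\<^sub>F \<sigma> in at_right 0.
           (\<Sum>b\<in>{- 1 / 2, 1 / 2}. L2norm_sq (\<lambda>x. exp (b * x) *\<^sub>R
              conv laplace_density
                (\<lambda>y. conv (gauss_kernel \<sigma>)
                       (T_op \<tau> (bandwidth_h c\<^sub>h \<sigma>) (bandwidth_delta c\<^sub>\<delta> \<sigma>) m b \<sigma> f\<^sub>0) y
                     - complex_of_real (f\<^sub>0 y)) x))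
           \<le> ennreal (C * \<sigma> powr (2 * (\<alpha> + 2)))"
      unfolding B_def[symmetric]
      using pos by (intro exI[where x = "1 + (\<Sum>b\<in>B. K b)"] conjI eventually_at_rightI[where b = 1] L2) auto
    show "\<forall>b\<in>{- 1 / 2, 1 / 2}.
           (\<forall>\<^sub>F \<sigma> in at_right 0. integrable lborel
              (h_corr \<tau> (bandwidth_h c\<^sub>h \<sigma>) (bandwidth_delta c\<^sub>\<delta> \<sigma>) m b \<sigma> f\<^sub>0)) \<and>
           (\<lambda>\<sigma>. (LINT x|lborel.
                   h_corr \<tau> (bandwidth_h c\<^sub>h \<sigma>) (bandwidth_delta c\<^sub>\<delta> \<sigma>) m b \<sigma> f\<^sub>0 x) - 1)
             \<in> O[at_right 0](\<lambda>\<sigma>. of_real (\<sigma> ^ (2 * (m - 1))))"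
      unfolding B_def[symmetric]
    proof (intro ballI conjI)
      fix b assume b: "b \<in> B"
      note * = h_corr_integral[OF assms(1) m(1) _ _ ch cd(1) B(1)[OF b]
          integrable_tilted_density[OF f g[OF b]] integral_tilted_density[OF f g[OF b]]]
      show "\<forall>\<^sub>F \<sigma> in at_right 0. integrable lborel
              (h_corr \<tau> (bandwidth_h c\<^sub>h \<sigma>) (bandwidth_delta c\<^sub>\<delta> \<sigma>) m b \<sigma> f\<^sub>0)"
        by (rule eventually_at_rightI[where b = 1]) (auto intro: *)
      show "(\<lambda>\<sigma>. (LINT x|lborel.
                   h_corr \<tau> (bandwidth_h c\<^sub>h \<sigma>) (bandwidth_delta c\<^sub>\<delta> \<sigma>) m b \<sigma> f\<^sub>0 x) - 1)
             \<in> O[at_right 0](\<lambda>\<sigma>. of_real (\<sigma> ^ (2 * (m - 1))))"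
        by (intro bigoI[where c = 8] eventually_at_rightI[where b = 1])
           (use *(2) in \<open>auto simp: norm_power\<close>)
    qed
  qed
qed

end
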